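(* Let $p\ge2$, let $\hat{\mathbf{A}}$ be a matrix with $m$ columns, $\mathbf{d}$ a vector, and $\mathbf{t}\in\mathbb{R}^m$ with $m^{-1/p}\le\mathbf{t}_e\le1$ for all $e$, and suppose the program $\min_{\Delta}\gamma_p(\mathbf{t},\Delta)$ subject to $\hat{\mathbf{A}}\Delta=\mathbf{d}$ has optimal value at most $1$. There is an algorithm that makes $O_p\!\left(m^{\frac{p-2}{3p-2}}\left(\log\frac{m\|\mathbf{d}\|_2^2}{\|\hat{\mathbf{A}}\|^2}\right)^{\frac{p}{3p-2}}\right)$ calls to the oracle described below and returns a vector $\mathbf{x}$ with $\hat{\mathbf{A}}\mathbf{x}=\mathbf{d}$ and $\gamma_p(\mathbf{t},\mathbf{x})=O_p(1)$.
   Context: For $t\ge0$, $p\ge1$, $x\in\mathbb{R}$: $\gamma_p(t,x)=\frac p2t^{p-2}x^2$ if $|x|\le t$, and $\gamma_p(t,x)=|x|^p+(\frac p2-1)t^p$ otherwise; for vectors $\gamma_p(\mathbf{t},\mathbf{x})=\sum_e\gamma_p(\mathbf{t}_e,\mathbf{x}_e)$. The oracle, given positive weights $\mathbf{r}\in\mathbb{R}^m$, returns $\arg\min_{\Delta}\sum_e\mathbf{r}_e\Delta_e^2$ subject to $\hat{\mathbf{A}}\Delta=\mathbf{d}$ (one weighted least-squares / linear system solve). $\|\hat{\mathbf{A}}\|$ denotes the operator norm (largest singular value). $O_p(\cdot)$ hides constants depending only on $p$.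
   Formalization: The logarithm in the call bound is read as max(1, log(m‖d‖²/‖A‖²)), since the literal power is undefined or zero when m‖d‖² ≤ ‖A‖²; the algorithm sees A and d only through the oracle and the norms ‖d‖ and ‖A‖. *)

theory Defs
  imports Complex_Main "Jordan_Normal_Form.Matrix"
begin

text \<open>The hidden constants must not depend on the dimension, so vectors and matrices are those of
  \<^theory>\<open>Jordan_Normal_Form.Matrix\<close>, whose dimensions can be quantified inside a formula.\<close>

definition gamma1 :: "real \<Rightarrow> real \<Rightarrow> real \<Rightarrow> real" where
  "gamma1 p t x = (if \<bar>x\<bar> \<le> t then p / 2 * t powr (p - 2) * x\<^sup>2
                   else \<bar>x\<bar> powr p + (p / 2 - 1) * t powr p)"

definition gamma :: "real \<Rightarrow> real vec \<Rightarrow> real vec \<Rightarrow> real" where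
  "gamma p t x = (\<Sum>e<dim_vec t. gamma1 p (t $ e) (x $ e))"

definition l2_norm :: "real vec \<Rightarrow> real" where
  "l2_norm v = sqrt (\<Sum>i<dim_vec v. (v $ i)\<^sup>2)"

definition operator_norm :: "real mat \<Rightarrow> real" where
  "operator_norm A = Sup {l2_norm (A *\<^sub>v v) | v. v \<in> carrier_vec (dim_col A) \<and> l2_norm v \<le> 1}"

definition feasible :: "real mat \<Rightarrow> real vec \<Rightarrow> real vec set" where
  "feasible A d = {\<Delta> \<in> carrier_vec (dim_col A). A *\<^sub>v \<Delta> = d}"

definition positive_weights :: "nat \<Rightarrow> real vec set" where
  "positive_weights m = {r \<in> carrier_vec m. \<forall>e<m. 0 < r $ e}"

text \<open>The minimiser exists and is unique whenever \<open>r\<close> is positive and \<open>feasible A d\<close> is nonempty;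
  other arguments yield an unspecified vector.\<close>

definition lsq_oracle :: "real mat \<Rightarrow> real vec \<Rightarrow> real vec \<Rightarrow> real vec" where
  "lsq_oracle A d r =
     (ARG_MIN (\<lambda>\<Delta>. \<Sum>e<dim_col A. r $ e * (\<Delta> $ e)\<^sup>2) \<Delta>. \<Delta> \<in> feasible A d)"

text \<open>Deterministic adaptive oracle algorithms: either stop with an output, or submit a weight
  vector and continue depending on the answer. Each run makes finitely many calls. The matrix and the right-hand side are
  visible to the algorithm only through the answers; an arbitrary function of them could output the
  optimum without any call.\<close>

datatype oracle_alg =
    Output "real vec"
  | Query "real vec" "real vec \<Rightarrow> oracle_alg"

primrec result :: "(real vec \<Rightarrow> real vec) \<Rightarrow> oracle_alg \<Rightarrow> real vec" where
  "result orc (Output x) = x"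
| "result orc (Query r k) = result orc (k (orc r))"

primrec queries :: "(real vec \<Rightarrow> real vec) \<Rightarrow> oracle_alg \<Rightarrow> real vec list" where
  "queries orc (Output x) = []"
| "queries orc (Query r k) = r # queries orc (k (orc r))"

text \<open>The logarithmic factor of the call bound. Inside the O-notation a logarithm is understood
  to be at least 1; otherwise the bound would be undefined or vanish for small \<open>d\<close>.\<close>

definition log_factor :: "real mat \<Rightarrow> real vec \<Rightarrow> real" where
  "log_factor A d =
     max 1 (ln (real (dim_col A) * (l2_norm d)\<^sup>2 / (operator_norm A)\<^sup>2))"

end

theory Submission
  imports Defs
begin

text \<open>Width-reduced multiplicative weights. Put \<open>r = (t\<^sup>2 + w\<^sup>2) powr ((p - 2) / 2)\<close> and
  \<open>Phi w = \<Sum> ((t\<^sup>2 + w\<^sup>2) powr (p / 2) - t powr p)\<close>, a smooth proxy for \<open>gamma p t w\<close> whose derivative is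
  \<open>p * r * w\<close>. Query the oracle at \<open>r\<close>. If the answer \<open>D\<close> has \<open>p\<close>-norm at most a threshold, take a
  primal step: add \<open>D / T\<close> to \<open>x\<close> and \<open>\<bar>D\<bar> / T\<close> to \<open>w\<close>. Otherwise multiply \<open>r\<close> by a constant on the
  coordinates with \<open>t\<^sup>2 + w\<^sup>2 \<le> D\<^sup>2\<close>. There the growth of \<open>Phi\<close> is at most a constant times the energy
  \<open>\<Sum> r * D\<^sup>2\<close> of these coordinates, which the optimal energy gains in the same step. Comparison with
  a near-optimal point bounds the energy in terms of \<open>Phi\<close> with a power below 1, so both stay
  \<open>O(1)\<close>. Each width step raises the energy by at least a constant times
  \<open>m powr (- (p - 2) / p) * T powr (2 * (p - 1) / p)\<close>, and \<open>T = m powr ((p - 2) / (3 * p - 2))\<close>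
  balances the two kinds of steps. As the energy gain is additive and not relative, the count needs
  no logarithm of the initial energy.\<close>

section \<open>Scalar estimates\<close>

definition resist :: "real \<Rightarrow> real \<Rightarrow> real \<Rightarrow> real" where
  "resist p t w = (t\<^sup>2 + w\<^sup>2) powr ((p - 2) / 2)"

text \<open>Subtracting \<open>t powr p\<close> makes the potential vanish at \<open>w = 0\<close>
  for \<open>t > 0\<close>; otherwise the initial sum alone could be of order
  \<open>m\<close>.\<close>

definition pot :: "real \<Rightarrow> real \<Rightarrow> real \<Rightarrow> real" where
  "pot p t w = (t\<^sup>2 + w\<^sup>2) powr (p / 2) - t powr p"

lemma sq_powr_half:
  fixes x q :: real
  shows "(x\<^sup>2) powr (q / 2) = \<bar>x\<bar> powr q"
proof (cases "x = 0")
  case False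
  then have "x\<^sup>2 = \<bar>x\<bar> powr 2" by (simp add: powr_numeral)
  then show ?thesis by (simp only: powr_powr) simp
qed simp

lemma powr_minus_2_mult_sq:
  fixes x p :: real
  assumes "p > 2"
  shows "\<bar>x\<bar> powr (p - 2) * x\<^sup>2 = \<bar>x\<bar> powr p"
proof (cases "x = 0")
  case False
  then show ?thesis using powr_add[of "\<bar>x\<bar>" "p - 2" 2] by (simp add: powr_numeral)
qed simp

lemma resist_pos: "t > 0 \<Longrightarrow> resist p t w > 0"
  by (simp add: resist_def add_pos_nonneg)

lemma resist_mult: "t > 0 \<Longrightarrow> resist p t w * (t\<^sup>2 + w\<^sup>2) = (t\<^sup>2 + w\<^sup>2) powr (p / 2)"
  using powr_add[of "t\<^sup>2 + w\<^sup>2" "(p - 2) / 2" 1] add_pos_nonneg[of "t\<^sup>2" "w\<^sup>2"]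
  by (simp add: resist_def diff_divide_distrib)

lemma resist_mono:
  assumes "p > 2" "0 \<le> w" "w \<le> w'"
  shows "resist p t w \<le> resist p t w'"
  unfolding resist_def using assms by (intro powr_mono2) (auto intro: power_mono)

lemma resist_ge_left: "p > 2 \<Longrightarrow> resist p t w \<ge> \<bar>t\<bar> powr (p - 2)"
  unfolding resist_def sq_powr_half[symmetric] by (intro powr_mono2) auto

lemma resist_ge_right: "p > 2 \<Longrightarrow> resist p t w \<ge> \<bar>w\<bar> powr (p - 2)"
  unfolding resist_def sq_powr_half[symmetric] by (intro powr_mono2) auto

text \<open>\<open>(t^2 + w^2) powr (p / 2)\<close> splits into \<open>resist p t w * t^2\<close>
  and \<open>resist p t w * w^2\<close>, and the first summand already covers
  \<open>t powr p\<close>.\<close>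

lemma pot_ge_quadratic:
  assumes "p > 2" "t > 0"
  shows "resist p t w * w\<^sup>2 \<le> pot p t w"
proof -
  have "t powr p = \<bar>t\<bar> powr (p - 2) * t\<^sup>2"
    using powr_minus_2_mult_sq[of p t] assms by simp
  also have "\<dots> \<le> resist p t w * t\<^sup>2"
    by (intro mult_right_mono resist_ge_left assms) auto
  finally show ?thesis
    using resist_mult[of t p w] assms by (simp add: pot_def algebra_simps)
qed

lemma pot_ge_powr:
  assumes "p > 2" "t > 0"
  shows "\<bar>w\<bar> powr p \<le> pot p t w"
proof -
  have "\<bar>w\<bar> powr p = \<bar>w\<bar> powr (p - 2) * w\<^sup>2"
    using powr_minus_2_mult_sq[of p w] assms by simp
  also have "\<dots> \<le> resist p t w * w\<^sup>2"
    by (intro mult_right_mono resist_ge_right assms) auto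
  finally show ?thesis using pot_ge_quadratic[OF assms, of w] by simp
qed

lemma pot_nonneg: "p > 2 \<Longrightarrow> t > 0 \<Longrightarrow> 0 \<le> pot p t w"
  using pot_ge_powr[of p t w] powr_ge_zero[of "\<bar>w\<bar>" p] by linarith

text \<open>Transfers a bound on the potential of a dominating weight to the objective. The inner
  branch of \<open>gamma1\<close> is covered by the quadratic lower bound of \<open>pot\<close>, the
  outer one by its power lower bound and \<open>t powr p <= |x| powr p\<close>.\<close>

lemma gamma1_le_pot:
  assumes "p > 2" "t > 0" "\<bar>x\<bar> \<le> w"
  shows "gamma1 p t x \<le> p / 2 * pot p t w"
proof -
  have "pot p t x \<le> pot p t w"
    using assms by (auto simp: pot_def intro!: powr_mono2 abs_le_square_iff[THEN iffD1])
  moreover have "gamma1 p t x \<le> p / 2 * pot p t x"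
  proof (cases "\<bar>x\<bar> \<le> t")
    case True
    have "t powr (p - 2) * x\<^sup>2 \<le> resist p t x * x\<^sup>2"
      using resist_ge_left[of p t x] assms by (intro mult_right_mono) auto
    also have "\<dots> \<le> pot p t x" using pot_ge_quadratic assms by blast
    finally have "p / 2 * (t powr (p - 2) * x\<^sup>2) \<le> p / 2 * pot p t x"
      using assms by (intro mult_left_mono) auto
    with True show ?thesis by (simp add: gamma1_def algebra_simps)
  next
    case False
    have "t powr p \<le> \<bar>x\<bar> powr p" using False assms by (intro powr_mono2) auto
    then have "(p / 2 - 1) * t powr p \<le> (p / 2 - 1) * \<bar>x\<bar> powr p"
      using assms by (intro mult_left_mono) auto
    then have "gamma1 p t x \<le> p / 2 * \<bar>x\<bar> powr p"
      using False by (simp add: gamma1_def algebra_simps)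
    also have "\<dots> \<le> p / 2 * pot p t x"
      using pot_ge_powr[of p t x] assms by (intro mult_left_mono) auto
    finally show ?thesis .
  qed
  ultimately show ?thesis
    using mult_left_mono[of "pot p t x" "pot p t w" "p / 2"] assms by linarith
qed

lemma gamma1_ge_quadratic:
  assumes "p > 2" "t > 0"
  shows "t powr (p - 2) * x\<^sup>2 \<le> gamma1 p t x"
proof (cases "\<bar>x\<bar> \<le> t")
  case True
  have "1 * (t powr (p - 2) * x\<^sup>2) \<le> p / 2 * (t powr (p - 2) * x\<^sup>2)"
    using assms by (intro mult_right_mono) auto
  with True show ?thesis by (simp add: gamma1_def)
next
  case False
  have "t powr (p - 2) * x\<^sup>2 \<le> \<bar>x\<bar> powr (p - 2) * x\<^sup>2"
    using False assms by (intro mult_right_mono powr_mono2) auto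
  also have "\<dots> = \<bar>x\<bar> powr p" using powr_minus_2_mult_sq assms by blast
  finally show ?thesis using False assms by (simp add: gamma1_def add_increasing2)
qed

lemma gamma1_ge_powr:
  assumes "p > 2" "t > 0"
  shows "\<bar>x\<bar> powr p \<le> gamma1 p t x"
proof (cases "\<bar>x\<bar> \<le> t")
  case True
  have "\<bar>x\<bar> powr p = \<bar>x\<bar> powr (p - 2) * x\<^sup>2"
    using powr_minus_2_mult_sq[of p x] assms by simp
  also have "\<dots> \<le> t powr (p - 2) * x\<^sup>2"
    using True assms by (intro mult_right_mono powr_mono2) auto
  finally show ?thesis using gamma1_ge_quadratic[OF assms, of x] by linarith
next
  case False
  then show ?thesis using assms by (simp add: gamma1_def)
qed

lemma gamma1_nonneg: "p \<ge> 2 \<Longrightarrow> t > 0 \<Longrightarrow> 0 \<le> gamma1 p t x"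
  by (simp add: gamma1_def)

text \<open>A Young-type inequality with free parameter \<open>l\<close>: increasing
  \<open>l\<close> shrinks the coefficient of \<open>pot\<close> at the expense of that of
  \<open>gamma1\<close>. The resistance is at most a constant times the power \<open>p - 2\<close>
  of the larger of \<open>t\<close> and \<open>w\<close>. When \<open>w\<close> is the larger, the
  product is charged to \<open>pot\<close> if \<open>l * |x| <= w\<close> and to
  \<open>|x| powr p\<close> otherwise.\<close>

lemma resist_mult_sq_le:
  assumes p: "p > 2" and t: "t > 0" and w: "w \<ge> 0" and l: "l \<ge> 1"
  shows "resist p t w * x\<^sup>2 \<le> 2 powr ((p - 2) / 2) *
           (gamma1 p t x + l powr (p - 2) * gamma1 p t x + pot p t w / l\<^sup>2)"
proof -
  have *: "resist p t w \<le> 2 powr ((p - 2) / 2) * v powr (p - 2)" if "t \<le> v" "w \<le> v" for v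
  proof -
    have "t\<^sup>2 \<le> v\<^sup>2" "w\<^sup>2 \<le> v\<^sup>2" using that t w by (auto intro: power_mono)
    then have "resist p t w \<le> (2 * v\<^sup>2) powr ((p - 2) / 2)"
      unfolding resist_def using p by (intro powr_mono2) auto
    also have "\<dots> = 2 powr ((p - 2) / 2) * v powr (p - 2)"
      using sq_powr_half[of v "p - 2"] that t by (simp add: powr_mult)
    finally show ?thesis .
  qed
  have g: "0 \<le> gamma1 p t x" "0 \<le> l powr (p - 2) * gamma1 p t x" "0 \<le> pot p t w / l\<^sup>2"
    using gamma1_nonneg pot_nonneg p t by auto
  obtain v where v: "t \<le> v" "w \<le> v"
    "v powr (p - 2) * x\<^sup>2 \<le> gamma1 p t x + l powr (p - 2) * gamma1 p t x + pot p t w / l\<^sup>2"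
  proof (cases "w \<le> t")
    case True
    then show ?thesis using that[of t] gamma1_ge_quadratic[OF p t, of x] g by linarith
  next
    case wt: False
    have "w powr (p - 2) * x\<^sup>2 \<le> l powr (p - 2) * gamma1 p t x + pot p t w / l\<^sup>2"
    proof (cases "l * \<bar>x\<bar> \<le> w")
      case True
      have "(l * \<bar>x\<bar>)\<^sup>2 \<le> w\<^sup>2" using True l by (intro power_mono) auto
      then have "x\<^sup>2 \<le> w\<^sup>2 / l\<^sup>2" using l by (simp add: field_simps power_mult_distrib)
      then have "w powr (p - 2) * x\<^sup>2 \<le> \<bar>w\<bar> powr (p - 2) * (w\<^sup>2 / l\<^sup>2)"
        using w by (intro mult_mono) auto
      also have "\<dots> = \<bar>w\<bar> powr p / l\<^sup>2" using powr_minus_2_mult_sq[OF p, of w] by simp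
      also have "\<dots> \<le> pot p t w / l\<^sup>2" using pot_ge_powr[OF p t] by (intro divide_right_mono) auto
      finally show ?thesis using g by linarith
    next
      case False
      then have "w powr (p - 2) * x\<^sup>2 \<le> (l * \<bar>x\<bar>) powr (p - 2) * x\<^sup>2"
        using w p by (intro mult_right_mono powr_mono2) auto
      also have "\<dots> = l powr (p - 2) * \<bar>x\<bar> powr p"
        using l powr_minus_2_mult_sq[OF p, of x] by (simp add: powr_mult)
      also have "\<dots> \<le> l powr (p - 2) * gamma1 p t x"
        using gamma1_ge_powr[OF p t] by (intro mult_left_mono) auto
      finally show ?thesis using g by linarith
    qed
    then show ?thesis using that[of w] wt g by linarith
  qed
  have "resist p t w * x\<^sup>2 \<le> 2 powr ((p - 2) / 2) * v powr (p - 2) * x\<^sup>2"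
    using *[OF v(1,2)] by (intro mult_right_mono) auto
  also have "\<dots> = 2 powr ((p - 2) / 2) * (v powr (p - 2) * x\<^sup>2)" by simp
  also have "\<dots> \<le> 2 powr ((p - 2) / 2) *
       (gamma1 p t x + l powr (p - 2) * gamma1 p t x + pot p t w / l\<^sup>2)"
    using v(3) by (intro mult_left_mono) auto
  finally show ?thesis .
qed

section \<open>Growth of the potential in one step\<close>

lemma powr_diff_le:
  fixes u v q :: real
  assumes "u > 0" "u \<le> v" "q \<ge> 1"
  shows "v powr q - u powr q \<le> q * (v - u) * v powr (q - 1)"
proof (cases "u = v")
  case False
  then have "u < v" using assms by simp
  moreover have "((\<lambda>x. x powr q) has_real_derivative q * x powr (q - 1)) (at x)"
    if "u \<le> x" for x
    using that assms by (auto intro!: derivative_eq_intros)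
  ultimately obtain z where z: "u < z" "z < v"
    "v powr q - u powr q = (v - u) * (q * z powr (q - 1))"
    using MVT2[of u v "\<lambda>x. x powr q" "\<lambda>x. q * x powr (q - 1)"] by blast
  have "z powr (q - 1) \<le> v powr (q - 1)" using z assms by (intro powr_mono2) auto
  then have "(v - u) * (q * z powr (q - 1)) \<le> (v - u) * (q * v powr (q - 1))"
    using z assms by (intro mult_left_mono) auto
  then show ?thesis using z by (simp add: algebra_simps)
qed simp

text \<open>The mean value bound gives \<open>p * (w * h + h^2) * resist p t (w + h)\<close>, with
  the resistance at the new point. Up to a constant this resistance is at most the old one if
  \<open>h <= sqrt (t^2 + w^2)\<close>, and at most \<open>h powr (p - 2)\<close> otherwise; the
  second case produces the term \<open>h powr p\<close>.\<close>

lemma pot_primal_step: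
  assumes p: "p > 2" and t: "t > 0" and w: "w \<ge> 0" and h: "h \<ge> 0"
  shows "pot p t (w + h) - pot p t w \<le>
    p * 2 powr (p - 1) * (resist p t w * w * h + resist p t w * h\<^sup>2 + h powr p)"
proof -
  let ?s = "t\<^sup>2 + w\<^sup>2"
  have s: "?s > 0" using t by (simp add: add_pos_nonneg)
  have ws: "w \<le> sqrt ?s" using t by (simp add: real_le_rsqrt)
  have r: "resist p t w > 0" using resist_pos t by blast
  have "pot p t (w + h) - pot p t w \<le>
      p / 2 * ((t\<^sup>2 + (w + h)\<^sup>2) - ?s) * (t\<^sup>2 + (w + h)\<^sup>2) powr (p / 2 - 1)"
    using powr_diff_le[of ?s "t\<^sup>2 + (w + h)\<^sup>2" "p / 2"] s p w h
    by (simp add: pot_def power_mono)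
  also have "\<dots> = p * (w * h + h\<^sup>2 / 2) * resist p t (w + h)"
    by (simp add: resist_def power2_eq_square algebra_simps diff_divide_distrib add_divide_distrib)
  also have "\<dots> \<le> p * (w * h + h\<^sup>2) * resist p t (w + h)"
    using p w h resist_pos[OF t, of p "w + h"] by (intro mult_right_mono mult_left_mono) auto
  finally have main: "pot p t (w + h) - pot p t w \<le> p * (w * h + h\<^sup>2) * resist p t (w + h)" .
  have four: "(4 :: real) powr ((p - 2) / 2) = 2 powr (p - 2)"
    using sq_powr_half[of 2 "p - 2"] by simp
  have two: "(2 :: real) powr (p - 1) = 2 * 2 powr (p - 2)"
    using powr_add[of 2 1 "p - 2"] by simp
  \<comment> \<open>Applied below with \<open>v = sqrt ?s\<close> and with \<open>v = h\<close>; the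
    constant comes from \<open>t^2 + (w + h)^2 <= 4 * v^2\<close>.\<close>
  have step: "resist p t (w + h) \<le> 2 powr (p - 2) * v powr (p - 2)" if v: "sqrt ?s \<le> v" "h \<le> v" for v
  proof -
    have "0 \<le> v" using v h by linarith
    have "?s \<le> v\<^sup>2" using v(1) \<open>0 \<le> v\<close> by (simp add: real_le_lsqrt sqrt_le_D)
    moreover have "2 * w * h \<le> 2 * (v * v)"
      using mult_mono[of w v h v] ws v w h \<open>0 \<le> v\<close> by simp
    moreover have "h\<^sup>2 \<le> v\<^sup>2" using v h by (intro power_mono) auto
    ultimately have "t\<^sup>2 + (w + h)\<^sup>2 \<le> 4 * v\<^sup>2" by (simp add: power2_eq_square algebra_simps)
    then have "resist p t (w + h) \<le> (4 * v\<^sup>2) powr ((p - 2) / 2)"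
      unfolding resist_def using p by (intro powr_mono2) auto
    also have "\<dots> = 2 powr (p - 2) * v powr (p - 2)"
      using \<open>0 \<le> v\<close> sq_powr_half[of v "p - 2"] by (simp add: powr_mult four)
    finally show ?thesis .
  qed
  have hp: "h powr (p - 2) * h\<^sup>2 = h powr p" using powr_minus_2_mult_sq[OF p, of h] h by simp
  have "(w * h + h\<^sup>2) * resist p t (w + h) \<le>
     2 powr (p - 1) * (resist p t w * w * h + resist p t w * h\<^sup>2 + h powr p)"
  proof (cases "h \<le> sqrt ?s")
    case True
    have "(sqrt ?s) powr (p - 2) = resist p t w"
      using sq_powr_half[of "sqrt ?s" "p - 2"] by (simp add: resist_def)
    then have "(w * h + h\<^sup>2) * resist p t (w + h) \<le> (w * h + h\<^sup>2) * (2 powr (p - 2) * resist p t w)"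
      using step[of "sqrt ?s"] True w h by (intro mult_left_mono) auto
    also have "\<dots> = 2 powr (p - 2) * (resist p t w * w * h + resist p t w * h\<^sup>2)"
      by (simp add: algebra_simps)
    also have "\<dots> \<le> 2 powr (p - 1) * (resist p t w * w * h + resist p t w * h\<^sup>2 + h powr p)"
      using r w h by (intro mult_mono) auto
    finally show ?thesis .
  next
    case False
    have "w * h + h\<^sup>2 \<le> 2 * h\<^sup>2" using False ws w h by (simp add: power2_eq_square mult_right_mono)
    then have "(w * h + h\<^sup>2) * resist p t (w + h) \<le> (2 * h\<^sup>2) * (2 powr (p - 2) * h powr (p - 2))"
      using step[of h] False w h resist_pos[OF t, of p "w + h"] by (intro mult_mono) auto
    also have "\<dots> = 2 powr (p - 1) * h powr p" using hp by (simp add: two mult.commute)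
    also have "\<dots> \<le> 2 powr (p - 1) * (resist p t w * w * h + resist p t w * h\<^sup>2 + h powr p)"
      using r w h by (intro mult_left_mono) auto
    finally show ?thesis .
  qed
  then have "p * ((w * h + h\<^sup>2) * resist p t (w + h)) \<le>
     p * (2 powr (p - 1) * (resist p t w * w * h + resist p t w * h\<^sup>2 + h powr p))"
    using p by (intro mult_left_mono) auto
  then show ?thesis using main by (simp add: mult.assoc)
qed

text \<open>The new weight is chosen so that \<open>t^2 + w^2\<close> doubles exactly.\<close>

lemma resist_width_step: "resist p t (sqrt (t\<^sup>2 + 2 * w\<^sup>2)) = 2 powr ((p - 2) / 2) * resist p t w"
proof -
  have "t\<^sup>2 + (sqrt (t\<^sup>2 + 2 * w\<^sup>2))\<^sup>2 = 2 * (t\<^sup>2 + w\<^sup>2)" by simp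
  then show ?thesis by (simp only: resist_def powr_mult)
qed

text \<open>The terms \<open>t powr p\<close> cancel and the old power is dropped. What remains is
  \<open>2 powr (p / 2) * (resist p t w * (t^2 + w^2))\<close>, and the hypothesis on
  \<open>h\<close> turns the last factor into \<open>h^2\<close>.\<close>

lemma pot_width_step:
  assumes p: "p > 2" and t: "t > 0" and h: "t\<^sup>2 + w\<^sup>2 \<le> h\<^sup>2"
  shows "pot p t (sqrt (t\<^sup>2 + 2 * w\<^sup>2)) - pot p t w \<le> 2 powr (p / 2) * (resist p t w * h\<^sup>2)"
proof -
  have "t\<^sup>2 + (sqrt (t\<^sup>2 + 2 * w\<^sup>2))\<^sup>2 = 2 * (t\<^sup>2 + w\<^sup>2)" by simp
  then have "pot p t (sqrt (t\<^sup>2 + 2 * w\<^sup>2)) - pot p t w \<le> (2 * (t\<^sup>2 + w\<^sup>2)) powr (p / 2)"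
    by (simp only: pot_def) simp
  also have "\<dots> = 2 powr (p / 2) * (resist p t w * (t\<^sup>2 + w\<^sup>2))"
    using t by (simp only: powr_mult resist_mult)
  also have "\<dots> \<le> 2 powr (p / 2) * (resist p t w * h\<^sup>2)"
    using h resist_pos[OF t, of p w] by (intro mult_left_mono) auto
  finally show ?thesis .
qed

text \<open>On the coordinates that a width step leaves alone, the p-th powers of the answer are
  controlled by its energy.\<close>

lemma powr_le_resist_mult_sq:
  assumes p: "p > 2" and h: "h\<^sup>2 < t\<^sup>2 + w\<^sup>2"
  shows "\<bar>h\<bar> powr p \<le> resist p t w * h\<^sup>2"
proof -
  have "\<bar>h\<bar> powr p = \<bar>h\<bar> powr (p - 2) * h\<^sup>2" using powr_minus_2_mult_sq[OF p, of h] by simp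
  also have "\<bar>h\<bar> powr (p - 2) \<le> resist p t w"
    unfolding resist_def sq_powr_half[symmetric] using p h by (intro powr_mono2) auto
  then have "\<bar>h\<bar> powr (p - 2) * h\<^sup>2 \<le> resist p t w * h\<^sup>2" by (intro mult_right_mono) auto
  finally show ?thesis .
qed

section \<open>The weighted least-squares oracle\<close>

lemma feasible_iff:
  assumes "A \<in> carrier_mat n m" "d \<in> carrier_vec n"
  shows "D \<in> feasible A d \<longleftrightarrow> dim_vec D = m \<and> (\<forall>i<n. (\<Sum>e<m. A $$ (i, e) * D $ e) = d $ i)"
proof -
  have "A *\<^sub>v D = d \<longleftrightarrow> (\<forall>i<n. (\<Sum>e<m. A $$ (i, e) * D $ e) = d $ i)" if "dim_vec D = m"
    using assms that by (auto simp: vec_eq_iff scalar_prod_def atLeast0LessThan)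
  moreover have "D \<in> feasible A d \<longleftrightarrow> dim_vec D = m \<and> A *\<^sub>v D = d"
    unfolding feasible_def carrier_matD(2)[OF assms(1)] carrier_vec_def by blast
  ultimately show ?thesis by blast
qed

text \<open>A minimising sequence is Cauchy in every coordinate: midpoints of feasible points are
  feasible, so the parallelogram identity bounds the weighted squared distance of two terms by their
  excess over the infimum, and positive weights pass this on to the coordinates. The limit is
  feasible and attains the infimum.\<close>

lemma feasible_nonempty_lsq_minimizer_exists:
  assumes A: "A \<in> carrier_mat n m" and d: "d \<in> carrier_vec n"
    and ne: "feasible A d \<noteq> {}" and r: "\<And>e. e < m \<Longrightarrow> 0 < r e"
  shows "\<exists>D\<in>feasible A d. \<forall>D'\<in>feasible A d.
           (\<Sum>e<m. r e * (D $ e)\<^sup>2) \<le> (\<Sum>e<m. r e * (D' $ e)\<^sup>2)"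
proof -
  let ?F = "\<lambda>D :: real vec. \<Sum>e<m. r e * (D $ e)\<^sup>2"
  define I where "I = Inf (?F ` feasible A d)"
  have Fnn: "0 \<le> ?F D" for D using r by (intro sum_nonneg) (simp add: less_imp_le)
  have bdd: "bdd_below (?F ` feasible A d)" by (rule bdd_belowI2[of _ 0]) (rule Fnn)
  have Ile: "I \<le> ?F D" if "D \<in> feasible A d" for D
    unfolding I_def using bdd that by (intro cInf_lower) auto
  have "\<exists>D\<in>feasible A d. ?F D < I + 1 / Suc k" for k
    using cInf_lessD[of "?F ` feasible A d" "I + 1 / Suc k"] ne by (auto simp: I_def)
  then obtain X where X: "\<And>k. X k \<in> feasible A d" "\<And>k. ?F (X k) < I + 1 / Suc k"
    by metis
  have close: "r e * (X k $ e - X l $ e)\<^sup>2 \<le> 2 / Suc k + 2 / Suc l" if "e < m" for e k l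
  proof -
    let ?M = "vec m (\<lambda>e. (X k $ e + X l $ e) / 2)"
    have "?M \<in> feasible A d"
    proof -
      have "(\<Sum>e<m. A $$ (i, e) * ((X k $ e + X l $ e) / 2)) = d $ i" if "i < n" for i
      proof -
        have "(\<Sum>e<m. A $$ (i, e) * ((X k $ e + X l $ e) / 2)) =
          ((\<Sum>e<m. A $$ (i, e) * X k $ e) + (\<Sum>e<m. A $$ (i, e) * X l $ e)) / 2"
          by (simp add: sum_divide_distrib flip: sum.distrib)
             (intro sum.cong refl, simp add: algebra_simps add_divide_distrib)
        then show ?thesis using X(1)[of k] X(1)[of l] that by (simp add: feasible_iff[OF A d])
      qed
      then show ?thesis by (simp add: feasible_iff[OF A d])
    qed
    then have "I \<le> ?F ?M" by (rule Ile)
    \<comment> \<open>Parallelogram identity; \<open>?F ?M\<close> is at least \<open>I\<close>, and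
      the two ends exceed \<open>I\<close> by less than \<open>1 / Suc k\<close> and
      \<open>1 / Suc l\<close>.\<close>
    moreover have "(\<Sum>e<m. r e * (X k $ e - X l $ e)\<^sup>2) = 2 * ?F (X k) + 2 * ?F (X l) - 4 * ?F ?M"
      unfolding sum_distrib_left sum.distrib[symmetric] sum_subtractf[symmetric]
      by (intro sum.cong refl) (simp add: power2_eq_square field_simps)
    ultimately have "(\<Sum>e<m. r e * (X k $ e - X l $ e)\<^sup>2) \<le> 2 / Suc k + 2 / Suc l"
      using X(2)[of k] X(2)[of l] by (simp del: of_nat_Suc)
    moreover have "r e * (X k $ e - X l $ e)\<^sup>2 \<le> (\<Sum>e<m. r e * (X k $ e - X l $ e)\<^sup>2)"
      using that r by (intro member_le_sum) (auto simp: less_imp_le)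
    ultimately show ?thesis by linarith
  qed
  have "convergent (\<lambda>k. X k $ e)" if e: "e < m" for e
  proof (rule real_Cauchy_convergent, rule metric_CauchyI)
    fix \<epsilon> :: real assume \<epsilon>: "\<epsilon> > 0"
    obtain N :: nat where N: "4 / (r e * \<epsilon>\<^sup>2) < N" using reals_Archimedean2 by blast
    have pos: "r e * \<epsilon>\<^sup>2 > 0" using r[OF e] \<epsilon> by simp
    have N0: "real N > 0" using N pos by (smt (verit) divide_pos_pos)
    show "\<exists>M. \<forall>k\<ge>M. \<forall>l\<ge>M. dist (X k $ e) (X l $ e) < \<epsilon>"
    proof (intro exI allI impI)
      fix k l assume "N \<le> k" "N \<le> l"
      then have "2 / Suc k \<le> 2 / real N" "2 / Suc l \<le> 2 / real N"
        using N0 by (auto intro!: divide_left_mono)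
      then have "r e * (X k $ e - X l $ e)\<^sup>2 \<le> 4 / real N"
        using close[OF e, of k l] by simp
      also have "\<dots> < r e * \<epsilon>\<^sup>2" using N N0 pos by (simp add: field_simps)
      finally have "(X k $ e - X l $ e)\<^sup>2 < \<epsilon>\<^sup>2" using r[OF e] by simp
      then have "\<bar>X k $ e - X l $ e\<bar> < \<epsilon>" using power2_less_imp_less[of "\<bar>X k $ e - X l $ e\<bar>" \<epsilon>] \<epsilon> by simp
      then show "dist (X k $ e) (X l $ e) < \<epsilon>" by (simp add: dist_real_def)
    qed
  qed
  then obtain L where L: "\<And>e. e < m \<Longrightarrow> (\<lambda>k. X k $ e) \<longlonglongrightarrow> L e"
    unfolding convergent_def by metis
  have "vec m L \<in> feasible A d"
  proof -
    have "(\<Sum>e<m. A $$ (i, e) * L e) = d $ i" if "i < n" for i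
    proof (rule LIMSEQ_unique)
      show "(\<lambda>k. \<Sum>e<m. A $$ (i, e) * X k $ e) \<longlonglongrightarrow> (\<Sum>e<m. A $$ (i, e) * L e)"
        by (intro tendsto_sum tendsto_mult tendsto_const L) auto
      show "(\<lambda>k. \<Sum>e<m. A $$ (i, e) * X k $ e) \<longlonglongrightarrow> d $ i"
        using X(1) that by (simp add: feasible_iff[OF A d])
    qed
    then show ?thesis by (simp add: feasible_iff[OF A d])
  qed
  moreover have "?F (vec m L) \<le> I"
  proof (rule LIMSEQ_le)
    show "(\<lambda>k. ?F (X k)) \<longlonglongrightarrow> ?F (vec m L)"
      by (intro tendsto_sum tendsto_mult tendsto_const tendsto_power) (simp add: L)
    show "(\<lambda>k. I + 1 / Suc k) \<longlonglongrightarrow> I"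
      using tendsto_add[OF tendsto_const[of I] LIMSEQ_inverse_real_of_nat]
      by (simp add: inverse_eq_divide)
    show "\<exists>N. \<forall>k\<ge>N. ?F (X k) \<le> I + 1 / Suc k" using X(2) less_imp_le by blast
  qed
  ultimately show ?thesis using Ile order_trans by blast
qed

lemma lsq_oracle_minimizer:
  assumes A: "A \<in> carrier_mat n m" and d: "d \<in> carrier_vec n"
    and ne: "feasible A d \<noteq> {}" and r: "r \<in> positive_weights m"
  shows "lsq_oracle A d r \<in> feasible A d"
    and "D \<in> feasible A d \<Longrightarrow>
      (\<Sum>e<m. r $ e * (lsq_oracle A d r $ e)\<^sup>2) \<le> (\<Sum>e<m. r $ e * (D $ e)\<^sup>2)"
proof -
  have "\<exists>D\<in>feasible A d. \<forall>D'\<in>feasible A d.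
           (\<Sum>e<m. r $ e * (D $ e)\<^sup>2) \<le> (\<Sum>e<m. r $ e * (D' $ e)\<^sup>2)"
    using feasible_nonempty_lsq_minimizer_exists[OF A d ne] r by (simp add: positive_weights_def)
  then have "\<exists>D. is_arg_min (\<lambda>D. \<Sum>e<m. r $ e * (D $ e)\<^sup>2) (\<lambda>D. D \<in> feasible A d) D"
    by (auto simp: is_arg_min_linorder)
  from someI_ex[OF this]
  have "is_arg_min (\<lambda>D. \<Sum>e<m. r $ e * (D $ e)\<^sup>2) (\<lambda>D. D \<in> feasible A d) (lsq_oracle A d r)"
    using A by (simp add: lsq_oracle_def arg_min_def)
  then show "lsq_oracle A d r \<in> feasible A d"
    and "D \<in> feasible A d \<Longrightarrow>
      (\<Sum>e<m. r $ e * (lsq_oracle A d r $ e)\<^sup>2) \<le> (\<Sum>e<m. r $ e * (D $ e)\<^sup>2)"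
    by (auto simp: is_arg_min_linorder)
qed

text \<open>Moving from the minimiser a fraction \<open>s\<close> of the way to \<open>D\<close> does not decrease the objective;
  letting \<open>s\<close> tend to 0 bounds the cross term.\<close>

lemma lsq_oracle_pythagoras:
  assumes A: "A \<in> carrier_mat n m" and d: "d \<in> carrier_vec n"
    and r: "r \<in> positive_weights m" and D: "D \<in> feasible A d"
  shows "(\<Sum>e<m. r $ e * (lsq_oracle A d r $ e)\<^sup>2)
           + (\<Sum>e<m. r $ e * (D $ e - lsq_oracle A d r $ e)\<^sup>2) \<le> (\<Sum>e<m. r $ e * (D $ e)\<^sup>2)"
proof -
  define O' where "O' = lsq_oracle A d r"
  have ne: "feasible A d \<noteq> {}" using D by blast
  note O = lsq_oracle_minimizer[OF A d ne r, folded O'_def]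
  define c where "c = (\<Sum>e<m. r $ e * (O' $ e * (D $ e - O' $ e)))"
  define g where "g = (\<Sum>e<m. r $ e * (D $ e - O' $ e)\<^sup>2)"
  have line: "0 \<le> 2 * c + s * g" if s: "s > 0" for s
  proof -
    let ?M = "vec m (\<lambda>e. O' $ e + s * (D $ e - O' $ e))"
    have "?M \<in> feasible A d"
    proof -
      have "(\<Sum>e<m. A $$ (i, e) * (O' $ e + s * (D $ e - O' $ e))) = d $ i" if "i < n" for i
      proof -
        have "(\<Sum>e<m. A $$ (i, e) * (O' $ e + s * (D $ e - O' $ e))) =
          (\<Sum>e<m. A $$ (i, e) * O' $ e)
            + s * ((\<Sum>e<m. A $$ (i, e) * D $ e) - (\<Sum>e<m. A $$ (i, e) * O' $ e))"
          unfolding sum_distrib_left sum.distrib[symmetric] sum_subtractf[symmetric]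
          by (intro sum.cong refl) (simp add: algebra_simps)
        then show ?thesis using O(1) D that by (simp add: feasible_iff[OF A d])
      qed
      then show ?thesis by (simp add: feasible_iff[OF A d])
    qed
    then have "(\<Sum>e<m. r $ e * (O' $ e)\<^sup>2) \<le> (\<Sum>e<m. r $ e * (?M $ e)\<^sup>2)" by (rule O(2))
    also have "\<dots> = (\<Sum>e<m. r $ e * (O' $ e)\<^sup>2) + s * (2 * c + s * g)"
      unfolding c_def g_def sum_distrib_left sum.distrib[symmetric]
      by (intro sum.cong refl) (simp add: power2_eq_square algebra_simps)
    finally show ?thesis using s by (simp add: zero_le_mult_iff)
  qed
  have "c \<ge> 0"
  proof (rule ccontr)
    assume "\<not> c \<ge> 0"
    have "g \<ge> 0" unfolding g_def using r
      by (intro sum_nonneg) (simp add: positive_weights_def less_imp_le)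
    \<comment> \<open>For \<open>s = - c / (g + 1)\<close> the product \<open>s * g\<close> is at
      most \<open>- c\<close>, so \<open>line\<close> would give \<open>0 <= c\<close>; the
      \<open>+ 1\<close> covers \<open>g = 0\<close>.\<close>
    then have "- c / (g + 1) > 0" "- c / (g + 1) * g \<le> - c"
      using \<open>\<not> c \<ge> 0\<close> by (auto simp: field_simps)
    then show False using line[of "- c / (g + 1)"] \<open>\<not> c \<ge> 0\<close> by linarith
  qed
  moreover have "(\<Sum>e<m. r $ e * (D $ e)\<^sup>2) = (\<Sum>e<m. r $ e * (O' $ e)\<^sup>2) + 2 * c + g"
    unfolding c_def g_def sum_distrib_left sum.distrib[symmetric]
    by (intro sum.cong refl) (simp add: power2_eq_square algebra_simps)
  ultimately show ?thesis unfolding O'_def[symmetric] g_def[symmetric] by simp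
qed

section \<open>Width-reduced multiplicative weights\<close>

text \<open>The arguments after the threshold \<open>\<tau>\<close> are fuel \<open>N\<close>, which bounds the number of calls, and
  the number \<open>k\<close> of primal steps still to be taken.\<close>

primrec mwu :: "real \<Rightarrow> real vec \<Rightarrow> nat \<Rightarrow> real \<Rightarrow> nat \<Rightarrow> nat \<Rightarrow> (nat \<Rightarrow> real) \<Rightarrow> (nat \<Rightarrow> real) \<Rightarrow> oracle_alg"
  where
    "mwu p t T \<tau> 0 k w x = Output (vec (dim_vec t) x)"
  | "mwu p t T \<tau> (Suc N) k w x =
      (if k = 0 then Output (vec (dim_vec t) x)
       else Query (vec (dim_vec t) (\<lambda>e. resist p (t $ e) (w e)))
         (\<lambda>D. if (\<Sum>e<dim_vec t. \<bar>D $ e\<bar> powr p) \<le> \<tau>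
               then mwu p t T \<tau> N (k - 1) (\<lambda>e. w e + \<bar>D $ e\<bar> / T) (\<lambda>e. x e + D $ e / T)
               else mwu p t T \<tau> N k
                 (\<lambda>e. if (t $ e)\<^sup>2 + (w e)\<^sup>2 \<le> (D $ e)\<^sup>2
                      then sqrt ((t $ e)\<^sup>2 + 2 * (w e)\<^sup>2) else w e) x))"

lemma length_queries_mwu: "length (queries orc (mwu p t T \<tau> N k w x)) \<le> N"
  by (induction N arbitrary: k w x) auto

lemma queries_mwu_positive:
  assumes "\<And>e. e < dim_vec t \<Longrightarrow> 0 < t $ e"
  shows "set (queries orc (mwu p t T \<tau> N k w x)) \<subseteq> positive_weights (dim_vec t)"
  by (induction N arbitrary: k w x) (auto simp: positive_weights_def resist_pos assms)

text \<open>The weights \<open>w\<close> dominate the coordinates of \<open>x\<close>, and \<open>Phi w\<close> bounds \<open>gamma p t x\<close>.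
  With \<open>k\<close> primal steps to go, the invariant is
  \<open>Phi w \<le> (1 - k / T) * M + b * energy w\<close>: a primal step costs at most \<open>M / T\<close>, and the cost of a
  width reduction step is paid by the growth of the energy. Since \<open>energy w\<close> is at most
  \<open>K1 * (l powr (p - 2) + Phi w / l\<^sup>2)\<close> for every \<open>l \<ge> 1\<close>, the invariant forces \<open>Phi w \<le> B\<close>.\<close>

locale mwu_instance =
  fixes p :: real and n m :: nat and A :: "real mat" and d t xs :: "real vec"
    and c b K K1 l \<epsilon> B E M :: real and T :: nat
  assumes p: "p > 2"
    and A: "A \<in> carrier_mat n m" and d: "d \<in> carrier_vec n" and t: "t \<in> carrier_vec m"
    and t_ge: "\<And>e. e < m \<Longrightarrow> real m powr (- 1 / p) \<le> t $ e"
    and xs: "xs \<in> feasible A d" and gamma_xs: "gamma p t xs \<le> 2"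
    and T: "T > 0"
    and c: "c = 1 - 1 / 2 powr ((p - 2) / 2)" and b: "b = 2 powr (p / 2) / c"
    and K: "K = p * 2 powr (p - 1)" and K1: "K1 = 4 * 2 powr ((p - 2) / 2)"
    and l: "l \<ge> 1" and \<epsilon>: "\<epsilon> > 0"
    and E: "E = K1 * (l powr (p - 2) + B / l\<^sup>2)"
    and M: "M = K * (\<epsilon> * B / 2 + E / (2 * \<epsilon>) + 3 * E)"
    and l_ge: "2 * b * K1 \<le> l\<^sup>2"
    and B: "B \<ge> 0" "2 * (M + b * K1 * l powr (p - 2)) \<le> B"
begin

section \<open>Energy and potential along a run\<close>

abbreviation rv :: "(nat \<Rightarrow> real) \<Rightarrow> nat \<Rightarrow> real" where
  "rv w e \<equiv> resist p (t $ e) (w e)"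

definition ans :: "(nat \<Rightarrow> real) \<Rightarrow> real vec" where
  "ans w = lsq_oracle A d (vec m (rv w))"

definition energy :: "(nat \<Rightarrow> real) \<Rightarrow> real" where
  "energy w = (\<Sum>e<m. rv w e * (ans w $ e)\<^sup>2)"

definition Phi :: "(nat \<Rightarrow> real) \<Rightarrow> real" where
  "Phi w = (\<Sum>e<m. pot p (t $ e) (w e))"

lemma dim_t [simp]: "dim_vec t = m"
  using t by simp

lemma t_pos: "e < m \<Longrightarrow> t $ e > 0"
  using t_ge[of e] powr_gt_zero[of "real m" "- 1 / p"] by linarith

lemma rv_pos: "e < m \<Longrightarrow> rv w e > 0"
  by (simp add: resist_pos t_pos)

lemma rv_positive: "vec m (rv w) \<in> positive_weights m"
  by (simp add: positive_weights_def rv_pos)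

lemma ans_feasible: "ans w \<in> feasible A d"
  unfolding ans_def using lsq_oracle_minimizer(1)[OF A d _ rv_positive] xs by blast

lemma energy_pythagoras:
  assumes "D \<in> feasible A d"
  shows "energy w + (\<Sum>e<m. rv w e * (D $ e - ans w $ e)\<^sup>2) \<le> (\<Sum>e<m. rv w e * (D $ e)\<^sup>2)"
  using lsq_oracle_pythagoras[OF A d rv_positive assms, of w] by (simp add: energy_def ans_def)

lemma energy_le:
  assumes "D \<in> feasible A d"
  shows "energy w \<le> (\<Sum>e<m. rv w e * (D $ e)\<^sup>2)"
proof -
  have "0 \<le> (\<Sum>e<m. rv w e * (D $ e - ans w $ e)\<^sup>2)"
    by (intro sum_nonneg) (simp add: less_imp_le rv_pos)
  then show ?thesis using energy_pythagoras[OF assms, of w] by linarith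
qed

lemma energy_nonneg: "0 \<le> energy w"
  unfolding energy_def by (intro sum_nonneg) (simp add: less_imp_le rv_pos)

lemma Phi_nonneg: "0 \<le> Phi w"
  unfolding Phi_def using p by (intro sum_nonneg) (simp add: pot_nonneg t_pos)

text \<open>The minimality of the old answer is tested against the new answer, whose weighted value
  only grows with the resistances.\<close>

lemma energy_mono:
  assumes "\<And>e. 0 \<le> w e" "\<And>e. w e \<le> w' e"
  shows "energy w \<le> energy w'"
proof -
  have "energy w \<le> (\<Sum>e<m. rv w e * (ans w' $ e)\<^sup>2)" by (intro energy_le ans_feasible)
  also have "\<dots> \<le> energy w'"
    unfolding energy_def using assms p by (intro sum_mono mult_right_mono resist_mono) auto
  finally show ?thesis .
qed

text \<open>The near-optimal \<open>xs\<close> competes in the least-squares problem, and the scalar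
  estimate is summed over the coordinates. Since \<open>gamma p t xs <= 2\<close> and
  \<open>l >= 1\<close>, the two \<open>gamma\<close> terms together are at most
  \<open>4 * l powr (p - 2)\<close>.\<close>

lemma energy_le_Phi:
  assumes w: "\<And>e. 0 \<le> w e"
  shows "energy w \<le> K1 * (l powr (p - 2) + Phi w / l\<^sup>2)"
proof -
  let ?g = "\<lambda>e. gamma1 p (t $ e) (xs $ e)"
  have "energy w \<le> (\<Sum>e<m. rv w e * (xs $ e)\<^sup>2)" by (intro energy_le xs)
  also have "\<dots> \<le> (\<Sum>e<m. 2 powr ((p - 2) / 2) *
       (?g e + l powr (p - 2) * ?g e + pot p (t $ e) (w e) / l\<^sup>2))"
    using p w l by (intro sum_mono resist_mult_sq_le) (auto simp: t_pos)
  also have "\<dots> = 2 powr ((p - 2) / 2) *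
       (gamma p t xs + l powr (p - 2) * gamma p t xs + Phi w / l\<^sup>2)"
    by (simp add: gamma_def Phi_def sum.distrib sum_distrib_left[symmetric]
        sum_divide_distrib[symmetric])
  also have "\<dots> \<le> 2 powr ((p - 2) / 2) * (4 * (l powr (p - 2) + Phi w / l\<^sup>2))"
  proof (rule mult_left_mono)
    have 1: "1 \<le> l powr (p - 2)" using l p by (simp add: ge_one_powr_ge_zero)
    have "l powr (p - 2) * gamma p t xs \<le> l powr (p - 2) * 2"
      using gamma_xs by (intro mult_left_mono) auto
    moreover have "0 \<le> Phi w / l\<^sup>2" using Phi_nonneg by simp
    ultimately show "gamma p t xs + l powr (p - 2) * gamma p t xs + Phi w / l\<^sup>2
        \<le> 4 * (l powr (p - 2) + Phi w / l\<^sup>2)"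
      using gamma_xs 1 by argo
  qed simp
  finally show ?thesis by (simp only: K1 mult.assoc mult.left_commute)
qed

lemma c_pos: "c > 0"
  using p by (simp add: c gr_one_powr)

lemma b_pos: "b > 0"
  using c_pos by (simp add: b)

lemma K1_pos: "K1 > 0"
  by (simp add: K1)

lemma K_pos: "K > 0"
  using p by (simp add: K)

lemma E_ge_1: "E \<ge> 1"
proof -
  have "1 \<le> l powr (p - 2)" using l p by (simp add: ge_one_powr_ge_zero)
  moreover have "K1 \<ge> 1" using p ge_one_powr_ge_zero[of 2 "(p - 2) / 2"] by (simp add: K1)
  ultimately have "1 * 1 \<le> K1 * (l powr (p - 2) + B / l\<^sup>2)"
    using B(1) by (intro mult_mono) (auto simp: add_increasing2)
  then show ?thesis by (simp add: E)
qed

lemma M_nonneg: "M \<ge> 0"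
  using K_pos \<epsilon> B(1) E_ge_1 by (simp add: M)

text \<open>Inserting the energy bound into the budget puts \<open>Phi w\<close> on both sides;
  \<open>l_ge\<close> keeps its coefficient on the right at most 1/2, so it can be absorbed.\<close>

lemma Phi_le_B:
  assumes w: "\<And>e. 0 \<le> w e" and budget: "Phi w \<le> M + b * energy w"
  shows "Phi w \<le> B"
proof -
  have "b * energy w \<le> b * (K1 * (l powr (p - 2) + Phi w / l\<^sup>2))"
    using energy_le_Phi[of w, OF w] b_pos by (intro mult_left_mono) auto
  also have "\<dots> = b * K1 * l powr (p - 2) + (b * K1 / l\<^sup>2) * Phi w"
    by (simp add: algebra_simps)
  finally have "b * energy w \<le> b * K1 * l powr (p - 2) + (b * K1 / l\<^sup>2) * Phi w" .
  moreover have "(b * K1 / l\<^sup>2) * Phi w \<le> 1 / 2 * Phi w"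
    using l_ge l Phi_nonneg by (intro mult_right_mono) (auto simp: field_simps)
  ultimately show ?thesis using budget B(2) by argo
qed

lemma energy_le_E:
  assumes w: "\<And>e. 0 \<le> w e" and "Phi w \<le> B"
  shows "energy w \<le> E"
proof -
  have "K1 * (l powr (p - 2) + Phi w / l\<^sup>2) \<le> E"
    unfolding E using assms(2) K1_pos by (intro mult_left_mono add_left_mono divide_right_mono) auto
  then show ?thesis using energy_le_Phi[of w, OF w] by linarith
qed

section \<open>Primal steps\<close>

text \<open>The power \<open>T powr (p - 1)\<close> makes the p-th power term of a primal step at
  most \<open>2 * E / T\<close>. The factor \<open>2 * E\<close> ensures that at least
  \<open>T powr (p - 1)\<close> is left for the wide coordinates once a share of at most
  \<open>E\<close> is removed.\<close>

definition \<tau> :: real where "\<tau> = 2 * E * real T powr (p - 1)"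

text \<open>Each of the three sums from \<open>pot_primal_step\<close> is at most a multiple of
  \<open>1 / T\<close>: the cross term by weighted AM-GM against \<open>Phi\<close> and the energy,
  the quadratic term as \<open>energy w / T^2 <= E / T\<close>, the power term by the threshold. The
  last two give the \<open>3 * E\<close> in \<open>M\<close>, and \<open>\<epsilon>\<close> keeps
  the direct contribution of \<open>B\<close> to \<open>M\<close> adjustable.\<close>

lemma Phi_primal_step:
  assumes w: "\<And>e. 0 \<le> w e" and PB: "Phi w \<le> B"
    and small: "(\<Sum>e<m. \<bar>ans w $ e\<bar> powr p) \<le> \<tau>"
  shows "Phi (\<lambda>e. w e + \<bar>ans w $ e\<bar> / T) \<le> Phi w + M / T"
proof -
  let ?h = "\<lambda>e. \<bar>ans w $ e\<bar> / T"
  have EE: "energy w \<le> E" using energy_le_E[of w, OF w PB] .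
  have cross: "rv w e * w e * ?h e \<le>
      (\<epsilon> / 2 * (rv w e * (w e)\<^sup>2) + 1 / (2 * \<epsilon>) * (rv w e * (ans w $ e)\<^sup>2)) / T"
    if e: "e < m" for e
  proof -
    have "0 \<le> (\<epsilon> * w e - \<bar>ans w $ e\<bar>)\<^sup>2" by simp
    then have "w e * \<bar>ans w $ e\<bar> \<le> \<epsilon> / 2 * (w e)\<^sup>2 + 1 / (2 * \<epsilon>) * (ans w $ e)\<^sup>2"
      using \<epsilon> by (simp add: power2_diff field_simps power2_eq_square)
    then have "rv w e * (w e * \<bar>ans w $ e\<bar>) \<le>
        rv w e * (\<epsilon> / 2 * (w e)\<^sup>2 + 1 / (2 * \<epsilon>) * (ans w $ e)\<^sup>2)"
      using rv_pos[OF e] by (intro mult_left_mono) (auto simp: less_imp_le)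
    then have "rv w e * (w e * \<bar>ans w $ e\<bar>) / T \<le>
        rv w e * (\<epsilon> / 2 * (w e)\<^sup>2 + 1 / (2 * \<epsilon>) * (ans w $ e)\<^sup>2) / T"
      by (intro divide_right_mono) auto
    then show ?thesis by (simp add: algebra_simps)
  qed
  have "(\<Sum>e<m. rv w e * w e * ?h e) \<le> (\<Sum>e<m.
      (\<epsilon> / 2 * (rv w e * (w e)\<^sup>2) + 1 / (2 * \<epsilon>) * (rv w e * (ans w $ e)\<^sup>2)) / T)"
    using cross by (intro sum_mono) auto
  also have "\<dots> = (\<epsilon> / 2 * (\<Sum>e<m. rv w e * (w e)\<^sup>2) + 1 / (2 * \<epsilon>) * energy w) / T"
    by (simp only: energy_def sum.distrib sum_distrib_left sum_divide_distrib[symmetric])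
  also have "\<dots> \<le> (\<epsilon> / 2 * B + 1 / (2 * \<epsilon>) * E) / T"
  proof -
    have "(\<Sum>e<m. rv w e * (w e)\<^sup>2) \<le> Phi w"
      unfolding Phi_def using p by (intro sum_mono pot_ge_quadratic) (auto simp: t_pos)
    then show ?thesis using PB EE \<epsilon>
      by (intro divide_right_mono add_mono mult_left_mono) auto
  qed
  finally have s1: "(\<Sum>e<m. rv w e * w e * ?h e) \<le> (\<epsilon> * B / 2 + E / (2 * \<epsilon>)) / T" by simp
  have "(\<Sum>e<m. rv w e * (?h e)\<^sup>2) = energy w / (real T)\<^sup>2"
    by (simp add: energy_def sum_divide_distrib power_divide)
  also have "\<dots> \<le> E / T"
  proof (rule frac_le)
    show "real T \<le> (real T)\<^sup>2" using T by (simp add: power2_eq_square)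
  qed (use EE E_ge_1 T in auto)
  finally have s2: "(\<Sum>e<m. rv w e * (?h e)\<^sup>2) \<le> E / T" .
  have "(\<Sum>e<m. ?h e powr p) = (\<Sum>e<m. \<bar>ans w $ e\<bar> powr p) / real T powr p"
    by (simp add: powr_divide sum_divide_distrib)
  also have "\<dots> \<le> \<tau> / real T powr p" using small by (intro divide_right_mono) auto
  also have "\<dots> = 2 * E / T"
    using T by (simp add: \<tau>_def powr_diff field_simps)
  finally have s3: "(\<Sum>e<m. ?h e powr p) \<le> 2 * E / T" .
  have "Phi (\<lambda>e. w e + ?h e) - Phi w = (\<Sum>e<m. pot p (t $ e) (w e + ?h e) - pot p (t $ e) (w e))"
    by (simp add: Phi_def sum_subtractf)
  also have "\<dots> \<le> (\<Sum>e<m. K * (rv w e * w e * ?h e + rv w e * (?h e)\<^sup>2 + ?h e powr p))"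
    unfolding K using p w by (intro sum_mono pot_primal_step) (auto simp: t_pos)
  also have "\<dots> = K * ((\<Sum>e<m. rv w e * w e * ?h e) + (\<Sum>e<m. rv w e * (?h e)\<^sup>2) + (\<Sum>e<m. ?h e powr p))"
    by (simp only: sum_distrib_left[symmetric] sum.distrib)
  also have "\<dots> \<le> K * ((\<epsilon> * B / 2 + E / (2 * \<epsilon>)) / T + E / T + 2 * E / T)"
    using s1 s2 s3 K_pos by (intro mult_left_mono add_mono) auto
  also have "\<dots> = M / T" by (simp add: M add_divide_distrib algebra_simps)
  finally show ?thesis by simp
qed

section \<open>Width reduction steps\<close>

definition wide :: "(nat \<Rightarrow> real) \<Rightarrow> nat set" where
  "wide w = {e. e < m \<and> (t $ e)\<^sup>2 + (w e)\<^sup>2 \<le> (ans w $ e)\<^sup>2}"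

definition widen :: "(nat \<Rightarrow> real) \<Rightarrow> nat \<Rightarrow> real" where
  "widen w = (\<lambda>e. if (t $ e)\<^sup>2 + (w e)\<^sup>2 \<le> (ans w $ e)\<^sup>2
                   then sqrt ((t $ e)\<^sup>2 + 2 * (w e)\<^sup>2) else w e)"

lemma wide_sub: "wide w \<subseteq> {..<m}" and finite_wide: "finite (wide w)"
  by (auto simp: wide_def)

lemma sum_wide: "(\<Sum>e<m. if e \<in> wide w then f e else 0) = sum f (wide w)"
  using wide_sub[of w] by (simp add: sum.If_cases Int_absorb1)

lemma widen_ge:
  assumes "0 \<le> w e"
  shows "w e \<le> widen w e"
proof -
  have "w e \<le> sqrt ((t $ e)\<^sup>2 + 2 * (w e)\<^sup>2)" by (rule real_le_rsqrt) simp
  then show ?thesis by (simp add: widen_def)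
qed

lemma Phi_widen: "Phi (widen w) \<le> Phi w + 2 powr (p / 2) * (\<Sum>e\<in>wide w. rv w e * (ans w $ e)\<^sup>2)"
proof -
  have "Phi (widen w) - Phi w = (\<Sum>e<m. pot p (t $ e) (widen w e) - pot p (t $ e) (w e))"
    by (simp add: Phi_def sum_subtractf)
  also have "\<dots> \<le> (\<Sum>e<m. if e \<in> wide w then 2 powr (p / 2) * (rv w e * (ans w $ e)\<^sup>2) else 0)"
    using p by (intro sum_mono) (auto simp: wide_def widen_def t_pos intro!: pot_width_step)
  also have "\<dots> = 2 powr (p / 2) * (\<Sum>e\<in>wide w. rv w e * (ans w $ e)\<^sup>2)"
    by (simp only: sum_wide sum_distrib_left)
  finally show ?thesis by simp
qed

text \<open>Pythagoras at the old resistances, applied to the new answer, yields the extra term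
  \<open>(a' - a)^2\<close>. On a wide coordinate the resistance grows by the factor
  \<open>q\<close>, and \<open>(q - 1) * a'^2 + (a' - a)^2\<close> is minimal at
  \<open>a' = a / q\<close> with value \<open>(1 - 1 / q) * a^2\<close>, which is the origin of
  \<open>c\<close>. So the energy rises wherever the new answer lies.\<close>

lemma energy_widen: "energy w + c * (\<Sum>e\<in>wide w. rv w e * (ans w $ e)\<^sup>2) \<le> energy (widen w)"
proof -
  let ?a = "\<lambda>e. ans w $ e" and ?a' = "\<lambda>e. ans (widen w) $ e"
  define q :: real where "q = 2 powr ((p - 2) / 2)"
  have q: "q > 1" using p by (simp add: q_def gr_one_powr)
  have cq: "c = 1 - 1 / q" by (simp add: c q_def)
  have pt: "rv w e * (?a' e)\<^sup>2 - rv w e * (?a' e - ?a e)\<^sup>2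
      + (if e \<in> wide w then c * (rv w e * (?a e)\<^sup>2) else 0)
      \<le> rv (widen w) e * (?a' e)\<^sup>2 - 0" if e: "e < m" for e
  proof (cases "e \<in> wide w")
    case True
    have "c * (?a e)\<^sup>2 \<le> (q - 1) * (?a' e)\<^sup>2 + (?a' e - ?a e)\<^sup>2"
    proof -
      have "(q - 1) * (?a' e)\<^sup>2 + (?a' e - ?a e)\<^sup>2 - c * (?a e)\<^sup>2 = (q * ?a' e - ?a e)\<^sup>2 / q"
        using q by (simp add: cq field_simps power2_eq_square)
      moreover have "0 \<le> (q * ?a' e - ?a e)\<^sup>2 / q" using q by simp
      ultimately show ?thesis by linarith
    qed
    then have "rv w e * (c * (?a e)\<^sup>2) \<le> rv w e * ((q - 1) * (?a' e)\<^sup>2 + (?a' e - ?a e)\<^sup>2)"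
      using rv_pos[OF e] by (intro mult_left_mono) (auto simp: less_imp_le)
    moreover have "rv (widen w) e = q * rv w e"
      using True resist_width_step by (simp add: widen_def wide_def q_def)
    ultimately show ?thesis using True by (simp add: algebra_simps)
  next
    case False
    then have "widen w e = w e" using e by (auto simp: widen_def wide_def)
    then show ?thesis using False rv_pos[OF e, of w] by (simp add: less_imp_le)
  qed
  have "energy w \<le> (\<Sum>e<m. rv w e * (?a' e)\<^sup>2) - (\<Sum>e<m. rv w e * (?a' e - ?a e)\<^sup>2)"
    using energy_pythagoras[OF ans_feasible, of w "widen w"] by linarith
  then have "energy w + c * (\<Sum>e\<in>wide w. rv w e * (ans w $ e)\<^sup>2)
     \<le> (\<Sum>e<m. rv w e * (?a' e)\<^sup>2 - rv w e * (?a' e - ?a e)\<^sup>2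
          + (if e \<in> wide w then c * (rv w e * (?a e)\<^sup>2) else 0))"
    by (simp only: sum.distrib sum_subtractf sum_wide sum_distrib_left)
  also have "\<dots> \<le> energy (widen w)"
    unfolding energy_def[of "widen w"] using pt by (intro sum_mono) auto
  finally show ?thesis .
qed

text \<open>The energy gain guaranteed in one width step, by \<open>energy_widen\<close> and
  \<open>wide_energy_ge\<close>.\<close>

definition \<eta> :: real where
  "\<eta> = c * (real m powr (- (p - 2) / p) * real T powr (2 * (p - 1) / p))"

text \<open>The narrow coordinates carry at most \<open>energy w <= E\<close> of the sum of p-th
  powers, so the wide ones carry at least \<open>\<tau> - E\<close>. Comparing p-norm and 2-norm
  turns this into \<open>S >= T powr (2 * (p - 1) / p)\<close>, and the lower bound on
  \<open>t\<close> makes every resistance at least \<open>m powr (- (p - 2) / p)\<close>.\<close>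

lemma wide_energy_ge:
  assumes EE: "energy w \<le> E" and large: "\<tau> < (\<Sum>e<m. \<bar>ans w $ e\<bar> powr p)"
  shows "real m powr (- (p - 2) / p) * real T powr (2 * (p - 1) / p)
           \<le> (\<Sum>e\<in>wide w. rv w e * (ans w $ e)\<^sup>2)"
proof -
  let ?a = "\<lambda>e. ans w $ e"
  define S where "S = (\<Sum>e\<in>wide w. (?a e)\<^sup>2)"
  have S: "S \<ge> 0" unfolding S_def by (intro sum_nonneg) auto
  have "(\<Sum>e\<in>{..<m} - wide w. \<bar>?a e\<bar> powr p) \<le> (\<Sum>e\<in>{..<m} - wide w. rv w e * (?a e)\<^sup>2)"
    using p by (intro sum_mono powr_le_resist_mult_sq) (auto simp: wide_def)
  also have "\<dots> \<le> energy w"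
    unfolding energy_def by (intro sum_mono2) (auto simp: less_imp_le rv_pos)
  finally have "\<tau> - E \<le> (\<Sum>e\<in>wide w. \<bar>?a e\<bar> powr p)"
    using large EE sum.subset_diff[OF wide_sub, of "\<lambda>e. \<bar>?a e\<bar> powr p" w] by simp
  \<comment> \<open>Both \<open>E\<close> and \<open>T powr (p - 1)\<close> are at least 1, so each
    is at most their product.\<close>
  moreover have "real T powr (p - 1) \<le> \<tau> - E"
  proof -
    have "1 \<le> real T powr (p - 1)" using T p by (intro ge_one_powr_ge_zero) auto
    then have "1 * real T powr (p - 1) + E * 1 \<le> E * real T powr (p - 1) + E * real T powr (p - 1)"
      using E_ge_1 by (intro add_mono mult_mono) auto
    then show ?thesis by (simp add: \<tau>_def)
  qed
  moreover have "(\<Sum>e\<in>wide w. \<bar>?a e\<bar> powr p) \<le> S powr (p / 2)"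
  proof -
    have "\<bar>?a e\<bar> powr p \<le> S powr ((p - 2) / 2) * (?a e)\<^sup>2" if "e \<in> wide w" for e
    proof -
      have "(?a e)\<^sup>2 \<le> S" unfolding S_def using that finite_wide by (intro member_le_sum) auto
      then have "((?a e)\<^sup>2) powr ((p - 2) / 2) \<le> S powr ((p - 2) / 2)"
        using p by (intro powr_mono2) auto
      then have "\<bar>?a e\<bar> powr (p - 2) * (?a e)\<^sup>2 \<le> S powr ((p - 2) / 2) * (?a e)\<^sup>2"
        unfolding sq_powr_half by (intro mult_right_mono) auto
      then show ?thesis using powr_minus_2_mult_sq[OF p] by simp
    qed
    then have "(\<Sum>e\<in>wide w. \<bar>?a e\<bar> powr p) \<le> (\<Sum>e\<in>wide w. S powr ((p - 2) / 2) * (?a e)\<^sup>2)"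
      by (rule sum_mono)
    also have "\<dots> = S powr ((p - 2) / 2) * S" by (simp add: S_def sum_distrib_left)
    also have "\<dots> = S powr (p / 2)"
      using S powr_add[of S "(p - 2) / 2" 1] by (simp add: diff_divide_distrib)
    finally show ?thesis .
  qed
  ultimately have "real T powr (p - 1) \<le> S powr (p / 2)" by linarith
  then have "(real T powr (p - 1)) powr (2 / p) \<le> (S powr (p / 2)) powr (2 / p)"
    using p by (intro powr_mono2) auto
  then have TS: "real T powr (2 * (p - 1) / p) \<le> S"
    using p S by (simp add: powr_powr mult.commute)
  have r_ge: "real m powr (- (p - 2) / p) \<le> rv w e" if e: "e < m" for e
  proof -
    have "real m powr (- (p - 2) / p) = (real m powr (- 1 / p)) powr (p - 2)"
      using minus_divide_left[of "p - 2" p] by (simp add: powr_powr)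
    also have "\<dots> \<le> t $ e powr (p - 2)" using t_ge[OF e] p by (intro powr_mono2) auto
    also have "\<dots> \<le> rv w e" using resist_ge_left[OF p, of "t $ e" "w e"] t_pos[OF e] by simp
    finally show ?thesis .
  qed
  have "real m powr (- (p - 2) / p) * real T powr (2 * (p - 1) / p) \<le> real m powr (- (p - 2) / p) * S"
    using TS by (intro mult_left_mono) auto
  also have "\<dots> = (\<Sum>e\<in>wide w. real m powr (- (p - 2) / p) * (?a e)\<^sup>2)"
    by (simp add: S_def sum_distrib_left)
  also have "\<dots> \<le> (\<Sum>e\<in>wide w. rv w e * (?a e)\<^sup>2)"
    using r_ge by (intro sum_mono mult_right_mono) (auto simp: wide_def)
  finally show ?thesis .
qed

section \<open>Correctness of a run\<close>

lemma output_correct: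
  assumes w: "\<And>e. 0 \<le> w e" and xw: "\<And>e. \<bar>x e\<bar> \<le> w e" and PB: "Phi w \<le> B"
    and lin: "\<And>i. i < n \<Longrightarrow> (\<Sum>e<m. A $$ (i, e) * x e) = d $ i"
  shows "vec m x \<in> feasible A d \<and> gamma p t (vec m x) \<le> p / 2 * B"
proof
  show "vec m x \<in> feasible A d" using lin by (simp add: feasible_iff[OF A d])
  have "gamma p t (vec m x) = (\<Sum>e<m. gamma1 p (t $ e) (x e))"
    by (simp add: gamma_def)
  also have "\<dots> \<le> (\<Sum>e<m. p / 2 * pot p (t $ e) (w e))"
    using p xw by (intro sum_mono gamma1_le_pot) (simp_all add: t_pos)
  also have "\<dots> = p / 2 * Phi w" by (simp only: Phi_def sum_distrib_left)
  also have "\<dots> \<le> p / 2 * B" using PB p by (intro mult_left_mono) auto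
  finally show "gamma p t (vec m x) \<le> p / 2 * B" .
qed

text \<open>Induction on the fuel, whose lower bound is a termination measure: a primal step lowers
  \<open>k\<close> by one while the energy does not fall, and a width step raises the energy by at
  least \<open>\<eta>\<close>, so each call lowers the measure by at least 1. Each primal step adds
  \<open>1 / T\<close> of a feasible point to \<open>x\<close> and hence \<open>1 / T\<close> of
  \<open>d\<close> to its image.\<close>

lemma mwu_result_correct:
  assumes m: "m > 0" and "\<And>e. 0 \<le> w e" and "\<And>e. \<bar>x e\<bar> \<le> w e"
    and "\<And>i. i < n \<Longrightarrow> (\<Sum>e<m. A $$ (i, e) * x e) = (1 - real k / T) * d $ i"
    and "k \<le> T" and "Phi w \<le> (1 - real k / T) * M + b * energy w"
    and "real k + (E - energy w) / \<eta> \<le> real N"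
  shows "result (lsq_oracle A d) (mwu p t T \<tau> N k w x) \<in> feasible A d \<and>
         gamma p t (result (lsq_oracle A d) (mwu p t T \<tau> N k w x)) \<le> p / 2 * B"
  using assms(2-)
proof (induction N arbitrary: k w x)
  case 0
  have eta: "\<eta> > 0" using c_pos m T by (simp add: \<eta>_def)
  have "(1 - real k / T) * M \<le> 1 * M" using M_nonneg T by (intro mult_right_mono) auto
  then have PB: "Phi w \<le> B" using Phi_le_B[of w, OF 0(1)] 0(5) by simp
  then have "0 \<le> (E - energy w) / \<eta>" using energy_le_E[of w, OF 0(1)] eta by simp
  \<comment> \<open>Without fuel the measure is at most 0, and both of its summands are
    nonnegative.\<close>
  then have "k = 0" using 0(6) by simp
  then show ?case using output_correct[of w x, OF 0(1,2) PB] 0(3) by simp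
next
  case IH: (Suc N)
  note w = IH.prems(1) and xw = IH.prems(2) and lin = IH.prems(3) and kT = IH.prems(4)
    and budget = IH.prems(5) and fuel = IH.prems(6)
  have eta: "\<eta> > 0" using c_pos m T by (simp add: \<eta>_def)
  have "(1 - real k / T) * M \<le> 1 * M" using M_nonneg T by (intro mult_right_mono) auto
  then have PB: "Phi w \<le> B" using Phi_le_B[of w, OF w] budget by simp
  then have EE: "energy w \<le> E" using energy_le_E[of w, OF w] by simp
  show ?case
  proof (cases "k = 0")
    case True
    then show ?thesis using output_correct[of w x, OF w xw PB] lin by simp
  next
    case k: False
    have orc: "lsq_oracle A d (vec (dim_vec t) (\<lambda>e. rv w e)) = ans w" by (simp add: ans_def)
    show ?thesis
    proof (cases "(\<Sum>e<m. \<bar>ans w $ e\<bar> powr p) \<le> \<tau>")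
      case True
      let ?w = "\<lambda>e. w e + \<bar>ans w $ e\<bar> / T" and ?x = "\<lambda>e. x e + ans w $ e / T"
      have k1: "real (k - 1) = real k - 1" using k by simp
      have frac: "1 - real (k - 1) / T = 1 - real k / T + 1 / T"
        using T unfolding k1 by (simp add: field_simps)
      have mono: "energy w \<le> energy ?w" using w by (intro energy_mono) auto
      have "result (lsq_oracle A d) (mwu p t T \<tau> N (k - 1) ?w ?x) \<in> feasible A d \<and>
         gamma p t (result (lsq_oracle A d) (mwu p t T \<tau> N (k - 1) ?w ?x)) \<le> p / 2 * B"
      proof (rule IH.IH)
        show "0 \<le> ?w e" for e using w[of e] by simp
        show "\<bar>?x e\<bar> \<le> ?w e" for e
          using xw[of e] abs_triangle_ineq[of "x e" "ans w $ e / T"] by simp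
        show "(\<Sum>e<m. A $$ (i, e) * ?x e) = (1 - real (k - 1) / T) * d $ i" if i: "i < n" for i
        proof -
          have "(\<Sum>e<m. A $$ (i, e) * ?x e) =
              (\<Sum>e<m. A $$ (i, e) * x e) + (\<Sum>e<m. A $$ (i, e) * ans w $ e) / T"
            by (simp add: sum.distrib algebra_simps sum_divide_distrib)
          also have "(\<Sum>e<m. A $$ (i, e) * ans w $ e) = d $ i"
            using ans_feasible i by (simp add: feasible_iff[OF A d])
          finally show ?thesis unfolding frac using lin[OF i] by (simp add: algebra_simps)
        qed
        show "k - 1 \<le> T" using kT by simp
        have "Phi ?w \<le> Phi w + M / T" using Phi_primal_step[of w, OF w PB True] .
        moreover have "b * energy w \<le> b * energy ?w" using mono b_pos by simp
        ultimately show "Phi ?w \<le> (1 - real (k - 1) / T) * M + b * energy ?w"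
          unfolding frac using budget by (simp add: algebra_simps)
        have "(E - energy ?w) / \<eta> \<le> (E - energy w) / \<eta>"
          using mono eta by (intro divide_right_mono) auto
        then show "real (k - 1) + (E - energy ?w) / \<eta> \<le> real N" using fuel k1 by simp
      qed
      then show ?thesis using True k orc by simp
    next
      case False
      let ?g = "\<Sum>e\<in>wide w. rv w e * (ans w $ e)\<^sup>2"
      have up: "energy w + c * ?g \<le> energy (widen w)" by (rule energy_widen)
      have "result (lsq_oracle A d) (mwu p t T \<tau> N k (widen w) x) \<in> feasible A d \<and>
         gamma p t (result (lsq_oracle A d) (mwu p t T \<tau> N k (widen w) x)) \<le> p / 2 * B"
      proof (rule IH.IH)
        show "0 \<le> widen w e" for e using widen_ge[of w e] w[of e] by linarith
        show "\<bar>x e\<bar> \<le> widen w e" for e using widen_ge[of w e] w[of e] xw[of e] by linarith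
        \<comment> \<open>As \<open>b * c = 2 powr (p / 2)\<close>, the gain in
          \<open>b * energy\<close> covers the growth of \<open>Phi\<close>.\<close>
        have "b * (energy w + c * ?g) \<le> b * energy (widen w)" using up b_pos by simp
        then have "b * energy w + 2 powr (p / 2) * ?g \<le> b * energy (widen w)"
          using c_pos by (simp add: b algebra_simps)
        then show "Phi (widen w) \<le> (1 - real k / T) * M + b * energy (widen w)"
          using Phi_widen[of w] budget by linarith
        have "\<eta> \<le> c * ?g"
          unfolding \<eta>_def using wide_energy_ge[OF EE] False c_pos by (intro mult_left_mono) auto
        then have "(E - energy (widen w)) / \<eta> \<le> (E - energy w - \<eta>) / \<eta>"
          using up eta by (intro divide_right_mono) auto
        also have "\<dots> = (E - energy w) / \<eta> - 1" using eta by (simp add: diff_divide_distrib)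
        finally show "real k + (E - energy (widen w)) / \<eta> \<le> real N" using fuel by simp
      qed (use lin kT in auto)
      then show ?thesis using False k orc by (simp add: widen_def)
    qed
  qed
qed
end

section \<open>Choice of the constants and count of the calls\<close>

text \<open>\<open>E\<close> and \<open>M\<close> grow with \<open>B\<close>, which in turn must
  dominate \<open>M\<close>, so \<open>l\<close> is fixed first. The choice
  \<open>\<epsilon> = 1 / (4 * K)\<close> gives \<open>2 * M = B / 4 + K2 * E\<close>; a large
  \<open>l\<close> limits the share of \<open>B\<close> in \<open>K2 * E\<close> to
  \<open>B / 4\<close>; the remaining \<open>B / 2\<close> is exactly
  \<open>(K2 * K1 + 2 * b * K1) * L\<close>, which pays for the rest.\<close>

lemma ex_mwu_constants:
  fixes p :: real
  assumes p: "p > 2" and K: "K = p * 2 powr (p - 1)" and K1: "K1 = 4 * 2 powr ((p - 2) / 2)" and b: "b > 0"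
  shows "\<exists>l \<epsilon> B E M. 1 \<le> l \<and> 0 < \<epsilon> \<and> E = K1 * (l powr (p - 2) + B / l\<^sup>2) \<and>
    M = K * (\<epsilon> * B / 2 + E / (2 * \<epsilon>) + 3 * E) \<and> 2 * b * K1 \<le> l\<^sup>2 \<and> 0 \<le> B \<and>
    2 * (M + b * K1 * l powr (p - 2)) \<le> B"
proof -
  define K2 where "K2 = 2 * K * (2 * K + 3)"
  define l where "l = 1 + 2 * b * K1 + 4 * K2 * K1"
  define L where "L = l powr (p - 2)"
  define B where "B = 2 * (K2 * K1 + 2 * b * K1) * L"
  define E where "E = K1 * (L + B / l\<^sup>2)"
  define M where "M = K * (1 / (4 * K) * B / 2 + E / (2 * (1 / (4 * K))) + 3 * E)"
  have "K > 0" "K1 > 0" using p by (simp_all add: K K1)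
  then have pos: "K > 0" "K1 > 0" "K2 > 0" by (simp_all add: K2_def add_pos_pos)
  have bK: "0 < b * K1" "0 < K2 * K1" using b pos by auto
  have l: "l \<ge> 1" unfolding l_def using bK by simp
  have "l * 1 \<le> l * l" using l by (intro mult_left_mono) auto
  then have l2: "l \<le> l\<^sup>2" by (simp add: power2_eq_square)
  have l_ge: "2 * b * K1 \<le> l\<^sup>2" "4 * (K2 * K1) \<le> l\<^sup>2"
    using l2 bK unfolding l_def by linarith+
  have L: "L > 0" using l by (simp add: L_def)
  have B: "B \<ge> 0" unfolding B_def using bK L by simp
  have "2 * M = B / 4 + K2 * E"
    using pos by (simp add: M_def K2_def field_simps)
  also have "K2 * E = K2 * K1 * L + K2 * K1 / l\<^sup>2 * B" by (simp add: E_def algebra_simps)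
  finally have "2 * M = B / 4 + (K2 * K1 * L + K2 * K1 / l\<^sup>2 * B)" .
  moreover have "K2 * K1 / l\<^sup>2 * B \<le> 1 / 4 * B"
    using l_ge l B by (intro mult_right_mono) (auto simp: field_simps)
  moreover have "B = 2 * (K2 * K1 * L) + 4 * (b * K1 * L)" by (simp add: B_def algebra_simps)
  ultimately have "2 * (M + b * K1 * L) \<le> B" by argo
  then show ?thesis
    using l pos B l_ge
    by (intro exI[of _ l] exI[of _ "1 / (4 * K)"] exI[of _ B] exI[of _ E] exI[of _ M])
       (simp add: E_def M_def flip: L_def)
qed

text \<open>With \<open>T = m powr \<theta>\<close> and
  \<open>\<theta> = (p - 2) / (3 * p - 2)\<close>, a width step gains energy of order
  \<open>m powr (- \<theta>)\<close>. A bounded energy thus admits only order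
  \<open>m powr \<theta>\<close> width steps, as many as there are primal steps.\<close>

lemma width_exponent:
  fixes p :: real
  assumes "p > 2"
  shows "- (p - 2) / p + (p - 2) / (3 * p - 2) * (2 * (p - 1) / p) = - ((p - 2) / (3 * p - 2))"
proof -
  have "p \<noteq> 0" "3 * p - 2 \<noteq> 0" using assms by auto
  then show ?thesis by (simp add: divide_simps) (simp add: algebra_simps)
qed

lemma mwu_algorithm:
  fixes p :: real
  assumes p: "p > 2"
  shows "\<exists>C alg. \<forall>n m A d t. 0 < m \<longrightarrow> A \<in> carrier_mat n m \<longrightarrow> d \<in> carrier_vec n \<longrightarrow>
    t \<in> carrier_vec m \<longrightarrow> (\<forall>e<m. real m powr (- 1 / p) \<le> t $ e) \<longrightarrow>
    (\<exists>xs\<in>feasible A d. gamma p t xs \<le> 2) \<longrightarrow>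
    set (queries (lsq_oracle A d) (alg t)) \<subseteq> positive_weights m \<and>
    real (length (queries (lsq_oracle A d) (alg t))) \<le> C * real m powr ((p - 2) / (3 * p - 2)) \<and>
    result (lsq_oracle A d) (alg t) \<in> feasible A d \<and>
    gamma p t (result (lsq_oracle A d) (alg t)) \<le> C"
proof -
  define c where "c = 1 - 1 / 2 powr ((p - 2) / 2)"
  define b where "b = 2 powr (p / 2) / c"
  define K where "K = p * 2 powr (p - 1)"
  define K1 :: real where "K1 = 4 * 2 powr ((p - 2) / 2)"
  define \<theta> where "\<theta> = (p - 2) / (3 * p - 2)"
  have c: "c > 0" using p by (simp add: c_def)
  then have "b > 0" by (simp add: b_def)
  then obtain l \<epsilon> B E M where const: "1 \<le> l" "0 < \<epsilon>" "E = K1 * (l powr (p - 2) + B / l\<^sup>2)"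
    "M = K * (\<epsilon> * B / 2 + E / (2 * \<epsilon>) + 3 * E)" "2 * b * K1 \<le> l\<^sup>2" "0 \<le> B"
    "2 * (M + b * K1 * l powr (p - 2)) \<le> B"
    using ex_mwu_constants[OF p K_def K1_def] by blast
  define T where "T m = nat \<lceil>real m powr \<theta>\<rceil>" for m
  define \<eta> where "\<eta> m = c * (real m powr (- (p - 2) / p) * real (T m) powr (2 * (p - 1) / p))" for m
  \<comment> \<open>\<open>T m\<close> primal steps, and at most \<open>E / \<eta> m\<close> width
    steps since the energy stays between 0 and \<open>E\<close>.\<close>
  define N where "N m = T m + nat \<lceil>E / \<eta> m\<rceil>" for m
  define alg where "alg t = (let m = dim_vec t in
    mwu p t (T m) (2 * E * real (T m) powr (p - 1)) (N m) (T m) (\<lambda>_. 0) (\<lambda>_. 0))" for t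
  \<comment> \<open>The first entry bounds the objective. The second bounds the calls:
    \<open>N m <= X + 1 + (E / c * X + 1)\<close> with
    \<open>X = m powr \<theta> >= 1\<close>.\<close>
  define C where "C = max (p / 2 * B) (3 + E / c)"
  have main: "set (queries (lsq_oracle A d) (alg t)) \<subseteq> positive_weights m \<and>
    real (length (queries (lsq_oracle A d) (alg t))) \<le> C * real m powr \<theta> \<and>
    result (lsq_oracle A d) (alg t) \<in> feasible A d \<and>
    gamma p t (result (lsq_oracle A d) (alg t)) \<le> C"
    if m: "0 < m" and A: "A \<in> carrier_mat n m" and d: "d \<in> carrier_vec n"
      and t: "t \<in> carrier_vec m" and t_ge: "\<forall>e<m. real m powr (- 1 / p) \<le> t $ e"
      and xs: "xs \<in> feasible A d" "gamma p t xs \<le> 2"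
    for n m A d t xs
  proof -
    define X where "X = real m powr \<theta>"
    have \<theta>: "\<theta> \<ge> 0" using p by (simp add: \<theta>_def)
    have X: "X \<ge> 1" unfolding X_def using m \<theta> by (intro ge_one_powr_ge_zero) auto
    have T: "X \<le> real (T m)" "real (T m) \<le> X + 1" "T m > 0"
      using X unfolding T_def X_def[symmetric] by linarith+
    interpret I: mwu_instance p n m A d t xs c b K K1 l \<epsilon> B E M "T m"
      using p A d t t_ge xs const T by unfold_locales (auto simp: c_def b_def K_def K1_def)
    have eta_eq: "\<eta> m = I.\<eta>"
      by (simp only: \<eta>_def I.\<eta>_def)
    have eta: "\<eta> m > 0" using c m T by (simp add: \<eta>_def)
    have alg: "alg t = mwu p t (T m) I.\<tau> (N m) (T m) (\<lambda>_. 0) (\<lambda>_. 0)"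
      by (simp add: alg_def Let_def I.\<tau>_def)
    have queries: "set (queries (lsq_oracle A d) (alg t)) \<subseteq> positive_weights m"
      unfolding alg using queries_mwu_positive[of t] I.t_pos t by simp
    have "c * real m powr (- \<theta>) \<le> \<eta> m"
    proof -
      have "real m powr (- \<theta>) = real m powr (- (p - 2) / p) * X powr (2 * (p - 1) / p)"
        using width_exponent[OF p]
        by (simp add: X_def powr_powr \<theta>_def flip: powr_add)
      also have "\<dots> \<le> real m powr (- (p - 2) / p) * real (T m) powr (2 * (p - 1) / p)"
        using T X p by (intro mult_left_mono powr_mono2) auto
      finally show ?thesis unfolding \<eta>_def using c by (intro mult_left_mono) auto
    qed
    then have "E / \<eta> m \<le> E / (c * real m powr (- \<theta>))"
      using I.E_ge_1 c m eta by (intro divide_left_mono) auto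
    also have "\<dots> = E / c * X" by (simp add: X_def powr_minus field_simps)
    finally have "E / \<eta> m \<le> E / c * X" .
    moreover have "0 \<le> E / \<eta> m" using I.E_ge_1 eta by simp
    ultimately have "real (N m) \<le> X + 1 + (E / c * X + 1)"
      unfolding N_def using T by linarith
    also have "\<dots> \<le> (3 + E / c) * X" using X by (simp add: algebra_simps)
    also have "\<dots> \<le> C * X" using X by (intro mult_right_mono) (auto simp: C_def)
    finally have count: "real (length (queries (lsq_oracle A d) (alg t))) \<le> C * X"
      unfolding alg using length_queries_mwu order_trans of_nat_mono by metis
    have "result (lsq_oracle A d) (alg t) \<in> feasible A d \<and>
        gamma p t (result (lsq_oracle A d) (alg t)) \<le> p / 2 * B"
      unfolding alg
    proof (rule I.mwu_result_correct)
      \<comment> \<open>The run starts with \<open>k = T\<close>, where the primal share of the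
        budget is 0; the normalisation of \<open>pot\<close> makes the initial potential
        fit.\<close>
      have "I.Phi (\<lambda>_. 0) = 0"
        unfolding I.Phi_def by (intro sum.neutral) (auto simp: pot_def sq_powr_half less_imp_le I.t_pos)
      then show "I.Phi (\<lambda>_. 0) \<le> (1 - real (T m) / real (T m)) * M + b * I.energy (\<lambda>_. 0)"
        using T I.b_pos I.energy_nonneg by simp
      have "(E - I.energy (\<lambda>_. 0)) / \<eta> m \<le> E / \<eta> m"
        using I.energy_nonneg eta by (intro divide_right_mono) auto
      then show "real (T m) + (E - I.energy (\<lambda>_. 0)) / I.\<eta> \<le> real (N m)"
        unfolding N_def eta_eq[symmetric] by linarith
    qed (use m T in auto)
    then show ?thesis using queries count by (auto simp: X_def C_def)
  qed
  show ?thesis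
    unfolding \<theta>_def[symmetric] using main by blast
qed

text \<open>For \<open>p = 2\<close> the constant \<open>c\<close> of the width steps would be 0.
  But then both branches of \<open>gamma1\<close> are the square, so one call with unit weights
  minimises \<open>gamma\<close> itself.\<close>

lemma single_query_algorithm:
  "\<exists>C alg. \<forall>n m A d t. 0 < m \<longrightarrow> A \<in> carrier_mat n m \<longrightarrow> d \<in> carrier_vec n \<longrightarrow>
    t \<in> carrier_vec m \<longrightarrow> (\<forall>e<m. real m powr (- 1 / 2) \<le> t $ e) \<longrightarrow>
    (\<exists>xs\<in>feasible A d. gamma 2 t xs \<le> 2) \<longrightarrow>
    set (queries (lsq_oracle A d) (alg t)) \<subseteq> positive_weights m \<and>
    real (length (queries (lsq_oracle A d) (alg t))) \<le> C * real m powr ((2 - 2) / (3 * 2 - 2)) \<and>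
    result (lsq_oracle A d) (alg t) \<in> feasible A d \<and>
    gamma 2 t (result (lsq_oracle A d) (alg t)) \<le> C"
proof -
  define alg where "alg t = Query (vec (dim_vec t) (\<lambda>_. 1)) Output" for t :: "real vec"
  have main: "set (queries (lsq_oracle A d) (alg t)) \<subseteq> positive_weights m \<and>
    real (length (queries (lsq_oracle A d) (alg t))) \<le> 2 * real m powr ((2 - 2) / (3 * 2 - 2)) \<and>
    result (lsq_oracle A d) (alg t) \<in> feasible A d \<and>
    gamma 2 t (result (lsq_oracle A d) (alg t)) \<le> 2"
    if m: "0 < m" and A: "A \<in> carrier_mat n m" and d: "d \<in> carrier_vec n"
      and t: "t \<in> carrier_vec m" and t_ge: "\<forall>e<m. real m powr (- 1 / 2) \<le> t $ e"
      and xs: "xs \<in> feasible A d" "gamma 2 t xs \<le> 2"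
    for n m A d t xs
  proof -
    let ?r = "vec m (\<lambda>_. 1) :: real vec"
    have r: "?r \<in> positive_weights m" by (simp add: positive_weights_def)
    have tpos: "t $ e > 0" if "e < m" for e
    proof -
      have "0 < real m powr (- 1 / 2)" using m by simp
      then show ?thesis using t_ge that by (meson order_less_le_trans)
    qed
    have "gamma1 2 (t $ e) y = y\<^sup>2" if "e < m" for e y
      using tpos[OF that] by (simp add: gamma1_def powr_numeral)
    then have g: "gamma 2 t y = (\<Sum>e<m. ?r $ e * (y $ e)\<^sup>2)" for y
      using t by (simp add: gamma_def)
    have ne: "feasible A d \<noteq> {}" using xs by blast
    note orc = lsq_oracle_minimizer[OF A d ne r]
    have "gamma 2 t (lsq_oracle A d ?r) \<le> 2" using orc(2)[OF xs(1)] xs(2) unfolding g by linarith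
    then show ?thesis using orc(1) r t m by (simp add: alg_def)
  qed
  show ?thesis
    using main by blast
qed

theorem theorem5p8:
  fixes p :: real
  assumes "p \<ge> 2"
  shows "\<exists>(C :: real) (alg :: real vec \<Rightarrow> real \<Rightarrow> real \<Rightarrow> oracle_alg).
    \<forall>(n :: nat) (m :: nat) (A :: real mat) (d :: real vec) (t :: real vec).
      A \<in> carrier_mat n m \<longrightarrow> d \<in> carrier_vec n \<longrightarrow> t \<in> carrier_vec m \<longrightarrow>
      (\<forall>e<m. real m powr (- 1 / p) \<le> t $ e \<and> t $ e \<le> 1) \<longrightarrow>
      feasible A d \<noteq> {} \<longrightarrow> (INF \<Delta>\<in>feasible A d. gamma p t \<Delta>) \<le> 1 \<longrightarrow>
      (let run = alg t (l2_norm d) (operator_norm A);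
           qs = queries (lsq_oracle A d) run;
           x = result (lsq_oracle A d) run
       in set qs \<subseteq> positive_weights m \<and>
          real (length qs) \<le> C * real m powr ((p - 2) / (3 * p - 2))
                               * log_factor A d powr (p / (3 * p - 2)) \<and>
          x \<in> carrier_vec m \<and> A *\<^sub>v x = d \<and> gamma p t x \<le> C)"
proof -
  obtain C alg where alg: "\<And>n m A d t. \<lbrakk>0 < m; A \<in> carrier_mat n m; d \<in> carrier_vec n;
    t \<in> carrier_vec m; \<forall>e<m. real m powr (- 1 / p) \<le> t $ e;
    \<exists>xs\<in>feasible A d. gamma p t xs \<le> 2\<rbrakk> \<Longrightarrow>
    set (queries (lsq_oracle A d) (alg t)) \<subseteq> positive_weights m \<and>
    real (length (queries (lsq_oracle A d) (alg t))) \<le> C * real m powr ((p - 2) / (3 * p - 2)) \<and>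
    result (lsq_oracle A d) (alg t) \<in> feasible A d \<and>
    gamma p t (result (lsq_oracle A d) (alg t)) \<le> C"
  proof (cases "p = 2")
    case True
    from single_query_algorithm show ?thesis
      using that unfolding True by (elim exE) blast
  next
    case False
    then have "p > 2" using assms by simp
    from mwu_algorithm[OF this] show ?thesis
      using that by (elim exE) blast
  qed
  \<comment> \<open>For \<open>m = 0\<close> the call bound is 0, because
    \<open>0 powr a = 0\<close>, so no query may be made; \<open>t\<close> is then the only vector
    of dimension 0 and hence the feasible one.\<close>
  define alg' where "alg' t a b = (if dim_vec t = 0 then Output t else alg t)"
    for t :: "real vec" and a b :: real
  \<comment> \<open>Nonnegativity lets the call bound be multiplied by a factor of at least
    1.\<close>
  define C' where "C' = max C 0"
  show ?thesis
  proof (rule exI[of _ C'], rule exI[of _ alg'], intro allI impI)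
    fix n m A d t
    assume A: "A \<in> carrier_mat n m" and d: "d \<in> carrier_vec n" and t: "t \<in> carrier_vec m"
      and tb: "\<forall>e<m. real m powr (- 1 / p) \<le> t $ e \<and> t $ e \<le> 1"
      and ne: "feasible A d \<noteq> {}" and opt: "(INF \<Delta>\<in>feasible A d. gamma p t \<Delta>) \<le> 1"
    \<comment> \<open>The \<open>max\<close> in \<open>log_factor\<close> ensures this even when
      \<open>operator_norm A = 0\<close>; so a call bound without logarithm implies the required
      one.\<close>
    have lf: "1 \<le> log_factor A d powr (p / (3 * p - 2))"
      using assms by (intro ge_one_powr_ge_zero) (auto simp: log_factor_def)
    let ?a = "alg' t (l2_norm d) (operator_norm A)"
    let ?X = "real m powr ((p - 2) / (3 * p - 2))"
    have "set (queries (lsq_oracle A d) ?a) \<subseteq> positive_weights m \<and>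
       real (length (queries (lsq_oracle A d) ?a)) \<le> C' * ?X \<and>
       result (lsq_oracle A d) ?a \<in> feasible A d \<and>
       gamma p t (result (lsq_oracle A d) ?a) \<le> C'"
    proof (cases "m = 0")
      case True
      obtain D where D: "D \<in> feasible A d" using ne by blast
      have "D = t" using D t True by (intro eq_vecI) (auto simp: feasible_iff[OF A d])
      then show ?thesis using D True t by (simp add: alg'_def gamma_def C'_def)
    next
      case False
      \<comment> \<open>Only the infimum is known to be at most 1; the slack up to 2 provides an
        actual feasible point.\<close>
      have "\<exists>xs\<in>feasible A d. gamma p t xs \<le> 2"
      proof -
        have "(INF \<Delta>\<in>feasible A d. gamma p t \<Delta>) < 2" using opt by simp
        then show ?thesis using cInf_lessD[of "gamma p t ` feasible A d" 2] ne
          by (force intro: less_imp_le)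
      qed
      then have "set (queries (lsq_oracle A d) (alg t)) \<subseteq> positive_weights m \<and>
        real (length (queries (lsq_oracle A d) (alg t))) \<le> C * ?X \<and>
        result (lsq_oracle A d) (alg t) \<in> feasible A d \<and>
        gamma p t (result (lsq_oracle A d) (alg t)) \<le> C"
        using alg[OF _ A d t] False tb by blast
      moreover have "C \<le> C'" "C * ?X \<le> C' * ?X" by (auto simp: C'_def intro: mult_right_mono)
      moreover have "?a = alg t" using False t by (simp add: alg'_def)
      ultimately show ?thesis by (metis order_trans)
    qed
    moreover have "C' * ?X * 1 \<le> C' * ?X * log_factor A d powr (p / (3 * p - 2))"
      using lf by (intro mult_left_mono) (auto simp: C'_def)
    ultimately show "let run = ?a; qs = queries (lsq_oracle A d) run; x = result (lsq_oracle A d) run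
       in set qs \<subseteq> positive_weights m \<and>
          real (length qs) \<le> C' * ?X * log_factor A d powr (p / (3 * p - 2)) \<and>
          x \<in> carrier_vec m \<and> A *\<^sub>v x = d \<and> gamma p t x \<le> C'"
      using A by (auto simp: Let_def feasible_def)
  qed
qed

end
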